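(* Let $b_0<0<b_1<\dots<b_n$ and let $\mathcal H\subset\mathbb RP^{n+1}$ be the projective quadric $b_0\xi_0^2+\dots+b_n\xi_n^2=\xi_{n+1}^2$, equipped with the pseudo-Riemannian metric obtained by extending to $\mathcal H$ the restriction of $ds_1^2=(B\,dx,dx)/|Bx|^2$. The projective Knörrer map $\nu:\mathcal H\to\mathbb RP^n$ maps the non-isotropic geodesics on $\mathcal H$ (in natural parameter) to solutions of the Neumann system on $\mathbb RP^n$ satisfying the relation $\Psi_0^\varepsilon(p,q)=0$.
   Context: $B=\mathrm{diag}(b_0,\dots,b_n)$, $A=B^{-1}$, and $(\cdot,\cdot)$, $|\cdot|$ are the Euclidean inner product and norm on $\mathbb R^{n+1}$. Quadric and metric. In the affine chart $\xi_{n+1}\ne0$ with coordinates $x_k=\xi_k/\xi_{n+1}$, $k=0,\dots,n$, the quadric $\mathcal H$ is the one-sheeted hyperboloid $(Bx,x)=1$, so $\mathcal H$ is its projective closure. The restriction to this hyperboloid of $$ds_1^2=\frac{b_0dx_0^2+\dots+b_ndx_n^2}{b_0^2x_0^2+\dots+b_n^2x_n^2}$$ extends to a regular (smooth, non-degenerate) pseudo-Riemannian metric on all of $\mathcal H$; e.g. in the chart $\xi_0\neq 0$ with $y_k=\xi_k/\xi_0$ it is the restriction to $\mathcal H$ of $\frac{b_1dy_1^2+\dots+b_ndy_n^2-dy_{n+1}^2}{b_0^2+b_1^2y_1^2+\dots+b_n^2y_n^2}$. A geodesic is non-isotropic if its velocity has non-zero square in this metric; the natural parameter $\tau$ is the one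 for which the square of the velocity equals $\varepsilon=\pm1$, and this defines the sign $\varepsilon$ of the geodesic. Map. In the chart $\xi_{n+1}\ne0$ the projective Knörrer map is $\nu(x)=[Bx]$ (the line spanned by $Bx$), extended to $\mathcal H$ by continuity, i.e. $\nu([\xi_0:\dots:\xi_{n+1}])=[b_0\xi_0:\dots:b_n\xi_n]$; it is smooth. Neumann system. On the unit sphere $S^n=\{q\in\mathbb R^{n+1}:|q|=1\}$ it is the system with Hamiltonian $H=\frac12|p|^2+\frac12\varepsilon(Bq,q)$, i.e. $p=\dot q$, $\ddot q=-\varepsilon Bq+\mu q$ with $\mu=\varepsilon(Bq,q)-(\dot q,\dot q)$, $\dot{}=d/d\tau$. It is invariant under $q\mapsto-q$ and therefore descends to $\mathbb RP^n=S^n/\pm1$. Finally, $\Psi^\varepsilon_u(p,q)=(1+(R_up,p))(R_uq,q)-(R_up,q)^2$ with $R_u=(uI-\varepsilon B)^{-1}$, so that $\Psi_0^\varepsilon(p,q)=(-\varepsilon+(Ap,p))(Aq,q)-(Ap,q)^2$ (invariant under $(p,q)\mapsto(-p,-q)$). *)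

theory Defs
  imports "HOL-Analysis.Analysis"
begin

section \<open>Conventions\<close>

text \<open>
  The index set \<open>{1..n}\<close> is a finite linearly ordered type \<open>'n\<close>, so \<open>n = CARD('n) \<ge> 1\<close>, and
  \<open>{0..n}\<close> is \<open>'n option\<close> with \<open>None\<close> in the role of \<open>0\<close>.  Homogeneous coordinates
  \<open>(\<xi>\<^sub>0, \<dots>, \<xi>\<^sub>n, \<xi>\<^sub>n\<^sub>+\<^sub>1)\<close> are pairs whose second component is \<open>\<xi>\<^sub>n\<^sub>+\<^sub>1\<close>.
\<close>

type_synonym 'n affine_vec = "real ^ ('n option)"
type_synonym 'n homog_vec = "(real ^ ('n option)) \<times> real"

definition diag_matrix :: "real ^ 'k \<Rightarrow> real ^ 'k ^ 'k"
  where "diag_matrix b = (\<chi> i j. if i = j then b $ i else 0)"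

section \<open>Real projective space, the quadric and its metric\<close>

text \<open>Points of the projective space of a vector space are its lines through the origin.\<close>

definition proj_point :: "'a::real_vector \<Rightarrow> 'a set"
  where "proj_point v = span {v}"

definition proj_space :: "'a::real_vector set set"
  where "proj_space = proj_point ` (- {0})"

definition quadric_form :: "real ^ ('n::finite option) \<Rightarrow> 'n homog_vec \<Rightarrow> 'n homog_vec \<Rightarrow> real"
  where "quadric_form b \<xi> \<eta> = (diag_matrix b *v fst \<xi>) \<bullet> fst \<eta> - snd \<xi> * snd \<eta>"

definition quadric :: "real ^ ('n::finite option) \<Rightarrow> 'n homog_vec set set"
  where "quadric b = proj_point ` {\<xi>. \<xi> \<noteq> 0 \<and> quadric_form b \<xi> \<xi> = 0}"

definition ds1 :: "real ^ 'k \<Rightarrow> real ^ 'k \<Rightarrow> real ^ 'k \<Rightarrow> real ^ 'k \<Rightarrow> real"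
  where "ds1 b x v w = ((diag_matrix b *v v) \<bullet> w) / (norm (diag_matrix b *v x))\<^sup>2"

text \<open>
  A tangent vector of the quadric at \<open>[\<xi>]\<close> is represented by a vector \<open>\<eta>\<close> tangent to the cone
  over the quadric at \<open>\<xi>\<close>, where \<open>(\<xi>, \<eta>)\<close> and \<open>(c \<xi>, c \<eta> + d \<xi>)\<close> represent the same tangent
  vector.
\<close>

definition quadric_tangent :: "real ^ ('n::finite option) \<Rightarrow> 'n homog_vec \<Rightarrow> 'n homog_vec set"
  where "quadric_tangent b \<xi> = {\<eta>. quadric_form b \<xi> \<eta> = 0}"

text \<open>
  The extension of the restriction of \<open>ds1\<close> to the whole quadric, on representatives of tangent
  vectors.  The lemmas below show that it does not depend on the representatives, that it is
  \<open>ds1\<close> in the chart \<open>\<xi>\<^sub>n\<^sub>+\<^sub>1 \<noteq> 0\<close>, that it has the expected form in the chart \<open>\<xi>\<^sub>0 \<noteq> 0\<close>, that it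
  is non-degenerate, and that it is the only continuous extension.
\<close>

definition quadric_metric ::
  "real ^ ('n::finite option) \<Rightarrow> 'n homog_vec \<Rightarrow> 'n homog_vec \<Rightarrow> 'n homog_vec \<Rightarrow> real"
  where "quadric_metric b \<xi> \<eta> \<zeta> = quadric_form b \<eta> \<zeta> / (norm (diag_matrix b *v fst \<xi>))\<^sup>2"

text \<open>
  Affine coordinates \<open>\<xi>\<^sub>k / \<xi>\<^sub>n\<^sub>+\<^sub>1\<close>, and the derivative of this map at \<open>\<xi>\<close> applied to \<open>\<eta>\<close>.
\<close>

definition affine_chart :: "('n::finite) homog_vec \<Rightarrow> 'n affine_vec"
  where "affine_chart \<xi> = fst \<xi> /\<^sub>R snd \<xi>"

definition affine_chart_deriv :: "('n::finite) homog_vec \<Rightarrow> 'n homog_vec \<Rightarrow> 'n affine_vec"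
  where "affine_chart_deriv \<xi> \<eta> = fst \<eta> /\<^sub>R snd \<xi> - (snd \<eta> / (snd \<xi>)\<^sup>2) *\<^sub>R fst \<xi>"

lemma affine_chart_has_derivative:
  fixes \<xi> :: "('n::finite) homog_vec"
  assumes "snd \<xi> \<noteq> 0"
  shows "(affine_chart has_derivative affine_chart_deriv \<xi>) (at \<xi>)"
  unfolding affine_chart_def [abs_def] affine_chart_deriv_def [abs_def]
  using assms
  by (auto intro!: derivative_eq_intros simp: fun_eq_iff field_simps power2_eq_square)

lemma diag_matrix_mult_nth: "(diag_matrix b *v x) $ i = b $ i * x $ i"
  by (simp add: diag_matrix_def matrix_vector_mult_def if_distrib [where f = "\<lambda>t. t * _"]
      cong: if_cong)

lemma quadric_form_sym: "quadric_form b \<xi> \<eta> = quadric_form b \<eta> \<xi>"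
  by (simp add: quadric_form_def inner_vec_def diag_matrix_mult_nth mult_ac)

lemma quadric_form_lin:
  "quadric_form b (\<xi> + \<eta>) \<zeta> = quadric_form b \<xi> \<zeta> + quadric_form b \<eta> \<zeta>"
  "quadric_form b \<zeta> (\<xi> + \<eta>) = quadric_form b \<zeta> \<xi> + quadric_form b \<zeta> \<eta>"
  "quadric_form b (c *\<^sub>R \<xi>) \<zeta> = c * quadric_form b \<xi> \<zeta>"
  "quadric_form b \<zeta> (c *\<^sub>R \<xi>) = c * quadric_form b \<zeta> \<xi>"
  by (simp_all add: quadric_form_def algebra_simps matrix_vector_right_distrib
      matrix_vector_mult_scaleR)

lemma quadric_metric_well_defined:
  assumes "quadric_form b \<xi> \<xi> = 0" "\<eta> \<in> quadric_tangent b \<xi>" "\<zeta> \<in> quadric_tangent b \<xi>"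
    and "c \<noteq> 0"
  shows "quadric_metric b (c *\<^sub>R \<xi>) (c *\<^sub>R \<eta> + d *\<^sub>R \<xi>) (c *\<^sub>R \<zeta> + e *\<^sub>R \<xi>)
    = quadric_metric b \<xi> \<eta> \<zeta>"
proof -
  have "quadric_form b (c *\<^sub>R \<eta> + d *\<^sub>R \<xi>) (c *\<^sub>R \<zeta> + e *\<^sub>R \<xi>) = c\<^sup>2 * quadric_form b \<eta> \<zeta>"
    using assms quadric_form_sym [of b \<eta> \<xi>]
    by (simp add: quadric_tangent_def quadric_form_lin power2_eq_square)
  then show ?thesis
    using assms(4) by (simp add: quadric_metric_def matrix_vector_mult_scaleR power_mult_distrib)
qed

lemma quadric_metric_affine_chart:
  assumes "quadric_form b \<xi> \<xi> = 0" "\<eta> \<in> quadric_tangent b \<xi>" "\<zeta> \<in> quadric_tangent b \<xi>"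
    and "snd \<xi> \<noteq> 0"
  shows "quadric_metric b \<xi> \<eta> \<zeta>
    = ds1 b (affine_chart \<xi>) (affine_chart_deriv \<xi> \<eta>) (affine_chart_deriv \<xi> \<zeta>)"
proof -
  let ?c = "inverse (snd \<xi>)"
  have *: "fst (?c *\<^sub>R v + (- (snd v / (snd \<xi>)\<^sup>2)) *\<^sub>R \<xi>) = affine_chart_deriv \<xi> v"
    "snd (?c *\<^sub>R v + (- (snd v / (snd \<xi>)\<^sup>2)) *\<^sub>R \<xi>) = 0" for v
    using assms(4) by (simp_all add: affine_chart_deriv_def field_simps power2_eq_square)
  have "quadric_metric b \<xi> \<eta> \<zeta> = quadric_metric b (?c *\<^sub>R \<xi>)
      (?c *\<^sub>R \<eta> + (- (snd \<eta> / (snd \<xi>)\<^sup>2)) *\<^sub>R \<xi>) (?c *\<^sub>R \<zeta> + (- (snd \<zeta> / (snd \<xi>)\<^sup>2)) *\<^sub>R \<xi>)"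
    using assms by (intro quadric_metric_well_defined [symmetric]) auto
  also have "\<dots> = ds1 b (affine_chart \<xi>) (affine_chart_deriv \<xi> \<eta>) (affine_chart_deriv \<xi> \<zeta>)"
    unfolding quadric_metric_def quadric_form_def * ds1_def by (simp add: affine_chart_def)
  finally show ?thesis .
qed

lemma sum_UNIV_option:
  "(\<Sum>i\<in>UNIV. f i) = f None + (\<Sum>k\<in>UNIV. f (Some k))" for f :: "'n::finite option \<Rightarrow> real"
  by (simp add: UNIV_option_conv sum.reindex)

lemma quadric_metric_chart0:
  fixes b :: "real ^ ('n::finite option)"
  assumes "fst \<xi> $ None = 1" "fst \<eta> $ None = 0"
  shows "quadric_metric b \<xi> \<eta> \<eta>
    = ((\<Sum>k\<in>UNIV. b $ Some k * (fst \<eta> $ Some k)\<^sup>2) - (snd \<eta>)\<^sup>2)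
      / ((b $ None)\<^sup>2 + (\<Sum>k\<in>UNIV. (b $ Some k)\<^sup>2 * (fst \<xi> $ Some k)\<^sup>2))"
  unfolding quadric_metric_def quadric_form_def power2_norm_eq_inner inner_vec_def
    diag_matrix_mult_nth sum_UNIV_option
  using assms by (simp add: power2_eq_square mult_ac)

lemma quadric_metric_nondegenerate:
  assumes b: "\<And>i. b $ i \<noteq> 0" and \<xi>: "\<xi> \<noteq> 0" "quadric_form b \<xi> \<xi> = 0"
    and \<eta>: "\<And>\<zeta>. \<zeta> \<in> quadric_tangent b \<xi> \<Longrightarrow> quadric_metric b \<xi> \<eta> \<zeta> = 0"
  shows "\<eta> \<in> span {\<xi>}"
proof -
  define J :: "'a homog_vec \<Rightarrow> 'a homog_vec" where "J v = (diag_matrix b *v fst v, - snd v)" for v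
  have J: "quadric_form b v w = J v \<bullet> w" for v w
    by (simp add: J_def quadric_form_def inner_prod_def)
  have Jinj: "v = w" if "J v = J w" for v w
  proof -
    have "diag_matrix b *v fst v = diag_matrix b *v fst w" "snd v = snd w"
      using that by (auto simp: J_def)
    then show ?thesis
      using b by (auto simp: prod_eq_iff vec_eq_iff diag_matrix_mult_nth)
  qed
  have J0: "J 0 = 0"
    by (simp add: J_def zero_prod_def)
  have Jsc: "J (c *\<^sub>R v) = c *\<^sub>R J v" for c v
    by (simp add: J_def matrix_vector_mult_scaleR)
  have a0: "J \<xi> \<noteq> 0"
    using Jinj [of \<xi> 0] J0 \<xi> by auto
  have n0: "diag_matrix b *v fst \<xi> \<noteq> 0"
  proof
    assume z: "diag_matrix b *v fst \<xi> = 0"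
    then have "snd \<xi> = 0"
      using \<xi> by (simp add: quadric_form_def)
    with z have "J \<xi> = 0"
      by (simp add: J_def zero_prod_def)
    with a0 show False
      by simp
  qed
  define c where "c = (J \<eta> \<bullet> J \<xi>) / (J \<xi> \<bullet> J \<xi>)"
  define w where "w = J \<eta> - c *\<^sub>R J \<xi>"
  have w: "J \<xi> \<bullet> w = 0"
    using a0 by (simp add: w_def c_def inner_diff_right inner_commute)
  then have "quadric_metric b \<xi> \<eta> w = 0"
    by (intro \<eta>) (simp add: quadric_tangent_def J)
  then have "J \<eta> \<bullet> w = 0"
    using n0 by (simp add: quadric_metric_def J)
  with w have "w \<bullet> w = 0"
    by (simp add: w_def inner_diff_left)
  then have "J \<eta> = J (c *\<^sub>R \<xi>)"
    by (simp add: w_def Jsc)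
  then show ?thesis
    using Jinj by (metis span_base span_scale insertI1)
qed

lemma quadric_metric_unique_extension:
  fixes b :: "real ^ ('n::finite option)"
    and g :: "'n homog_vec \<Rightarrow> 'n homog_vec \<Rightarrow> 'n homog_vec \<Rightarrow> real"
  defines "T \<equiv> {(\<xi>, \<eta>, \<zeta>). \<xi> \<noteq> 0 \<and> quadric_form b \<xi> \<xi> = 0
    \<and> \<eta> \<in> quadric_tangent b \<xi> \<and> \<zeta> \<in> quadric_tangent b \<xi>}"
  assumes b: "b $ None < 0" "\<And>k. 0 < b $ Some k"
    and cont: "continuous_on T (\<lambda>(\<xi>, \<eta>, \<zeta>). g \<xi> \<eta> \<zeta>)"
    and ext: "\<And>\<xi> \<eta> \<zeta>. (\<xi>, \<eta>, \<zeta>) \<in> T \<Longrightarrow> snd \<xi> \<noteq> 0 \<Longrightarrow>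
      g \<xi> \<eta> \<zeta> = ds1 b (affine_chart \<xi>) (affine_chart_deriv \<xi> \<eta>) (affine_chart_deriv \<xi> \<zeta>)"
    and mem: "(\<xi>, \<eta>, \<zeta>) \<in> T"
  shows "g \<xi> \<eta> \<zeta> = quadric_metric b \<xi> \<eta> \<zeta>"
proof (cases "snd \<xi> = 0")
  case False
  then show ?thesis
    using ext [OF mem False] mem quadric_metric_affine_chart [of b \<xi> \<eta> \<zeta>] by (simp add: T_def)
next
  case True
  define s where "s = sqrt (- (b $ None))"
  have s: "s > 0" "s * s = - (b $ None)"
    using b(1) by (auto simp: s_def)
  define R :: "real \<Rightarrow> 'n homog_vec \<Rightarrow> 'n homog_vec" where
    "R \<theta> v = (fst v + ((cos \<theta> - 1) * fst v $ None - sin \<theta> / s * snd v) *\<^sub>R axis None 1,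
      s * sin \<theta> * fst v $ None + cos \<theta> * snd v)" for \<theta> v
  have form: "quadric_form b v w = b $ None * fst v $ None * fst w $ None
      + (\<Sum>k\<in>UNIV. b $ Some k * fst v $ Some k * fst w $ Some k) - snd v * snd w" for v w
    unfolding quadric_form_def inner_vec_def diag_matrix_mult_nth sum_UNIV_option by simp
  have R_form: "quadric_form b (R \<theta> v) (R \<theta> w) = quadric_form b v w" for \<theta> v w
  proof -
    have c: "cos \<theta> * cos \<theta> = 1 - sin \<theta> * sin \<theta>"
      using sin_cos_squared_add [of \<theta>] by (simp add: power2_eq_square)
    have alg: "b0 * (x + ((C - 1) * x - S / s * z)) * (y + ((C - 1) * y - S / s * w)) 
        - (s * S * x + C * z) * (s * S * y + C * w) = b0 * x * y - z * w"
      if "C * C = 1 - S * S" "b0 = - (s * s)" for C S x y z w b0 :: real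
    proof -
      have e: "x + ((C - 1) * x - S / s * z) = (s * C * x - S * z) / s"
        "y + ((C - 1) * y - S / s * w) = (s * C * y - S * w) / s"
        using s(1) by (simp_all add: field_simps)
      have "b0 * ((s * C * x - S * z) / s) * ((s * C * y - S * w) / s)
          = - ((s * C * x - S * z) * (s * C * y - S * w))"
        using s(1) that(2) by (simp add: field_simps)
      then show ?thesis
        unfolding e using that by algebra
    qed
    show ?thesis
      using alg [OF c, of "b $ None"] s(2)
      by (simp add: form R_def axis_def)
  qed
  have R0: "R 0 v = v" for v
    by (simp add: R_def)
  have R_cont: "continuous_on UNIV (\<lambda>\<theta>. R \<theta> v)" for v
    unfolding R_def by (intro continuous_intros) (use s in auto)
  have nz: "diag_matrix b *v fst v \<noteq> 0" if "v \<noteq> 0" "quadric_form b v v = 0" for v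
  proof
    assume z: "diag_matrix b *v fst v = 0"
    have "b $ i \<noteq> 0" for i
      using b(1) b(2) [of "the i"] by (cases i) auto
    with z have "fst v = 0"
      by (auto simp: vec_eq_iff diag_matrix_mult_nth)
    moreover have "snd v = 0"
      using z that(2) by (simp add: quadric_form_def)
    ultimately show False
      using that(1) by (simp add: prod_eq_iff)
  qed
  have x0: "fst \<xi> $ None \<noteq> 0"
  proof
    assume z: "fst \<xi> $ None = 0"
    have "(\<Sum>k\<in>UNIV. b $ Some k * fst \<xi> $ Some k * fst \<xi> $ Some k) = 0"
      using mem z True by (simp add: T_def form)
    then have "\<forall>k\<in>UNIV. b $ Some k * fst \<xi> $ Some k * fst \<xi> $ Some k = 0"
      by (subst (asm) sum_nonneg_eq_0_iff) (auto simp: mult.assoc less_imp_le [OF b(2)])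
    then have "fst \<xi> $ Some k = 0" for k
      using b(2) [of k] by (auto dest: spec [of _ k])
    then have "fst \<xi> $ i = 0" for i
      using z by (cases i) auto
    then show False
      using mem True by (auto simp: T_def prod_eq_iff vec_eq_iff)
  qed
  have R_nz: "R \<theta> \<xi> \<noteq> 0" for \<theta>
  proof
    assume "R \<theta> \<xi> = 0"
    then have "s * sin \<theta> * fst \<xi> $ None = 0" "fst (R \<theta> \<xi>) $ None = 0"
      using True by (auto simp: R_def prod_eq_iff)
    then have "sin \<theta> = 0" "cos \<theta> * fst \<xi> $ None = 0"
      using s x0 True by (auto simp: R_def algebra_simps)
    then show False
      using x0 sin_cos_squared_add [of \<theta>] by auto
  qed
  have R_mem: "(R \<theta> \<xi>, R \<theta> \<eta>, R \<theta> \<zeta>) \<in> T" for \<theta>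
    using mem R_nz by (simp add: T_def quadric_tangent_def R_form)
  have c1: "continuous_on UNIV (\<lambda>\<theta>. g (R \<theta> \<xi>) (R \<theta> \<eta>) (R \<theta> \<zeta>))"
    using continuous_on_compose2 [OF cont, of UNIV "\<lambda>\<theta>. (R \<theta> \<xi>, R \<theta> \<eta>, R \<theta> \<zeta>)"]
      continuous_on_Pair [OF R_cont continuous_on_Pair [OF R_cont R_cont]] R_mem
    by (simp add: image_subset_iff)
  have c2: "continuous_on UNIV (\<lambda>\<theta>. quadric_metric b (R \<theta> \<xi>) (R \<theta> \<eta>) (R \<theta> \<zeta>))"
    unfolding quadric_metric_def R_form
    using R_mem nz
    by (intro continuous_intros matrix_vector_mult_linear_continuous_on
        continuous_on_compose2 [OF linear_continuous_on [OF matrix_vector_mul_bounded_linear]]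
        R_cont) (auto simp: T_def)
  have eq: "g (R \<theta> \<xi>) (R \<theta> \<eta>) (R \<theta> \<zeta>) = quadric_metric b (R \<theta> \<xi>) (R \<theta> \<eta>) (R \<theta> \<zeta>)"
    if "0 < \<theta>" "\<theta> \<le> 1" for \<theta>
  proof -
    have "sin \<theta> > 0"
      using that pi_gt3 by (intro sin_gt_zero) auto
    then have nz': "snd (R \<theta> \<xi>) \<noteq> 0"
      using s x0 True by (simp add: R_def)
    show ?thesis
      using ext [OF R_mem nz'] R_mem [of \<theta>] nz'
        quadric_metric_affine_chart [of b "R \<theta> \<xi>" "R \<theta> \<eta>" "R \<theta> \<zeta>"]
      by (simp add: T_def)
  qed
  have lim: "(\<lambda>m. f (inverse (real (Suc m)))) \<longlonglongrightarrow> f 0" if "continuous_on UNIV f" for f :: "real \<Rightarrow> real"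
    using that LIMSEQ_inverse_real_of_nat
    by (auto simp: continuous_on_eq_continuous_at intro: isCont_tendsto_compose)
  have e: "g (R (inverse (real (Suc m))) \<xi>) (R (inverse (real (Suc m))) \<eta>) (R (inverse (real (Suc m))) \<zeta>)
     = quadric_metric b (R (inverse (real (Suc m))) \<xi>) (R (inverse (real (Suc m))) \<eta>) (R (inverse (real (Suc m))) \<zeta>)"
    for m
    by (rule eq) (auto simp: field_simps)
  have "g (R 0 \<xi>) (R 0 \<eta>) (R 0 \<zeta>) = quadric_metric b (R 0 \<xi>) (R 0 \<eta>) (R 0 \<zeta>)"
    using LIMSEQ_unique [OF lim [OF c1, unfolded e] lim [OF c2]] .
  then show ?thesis
    by (simp add: R0)
qed

section \<open>Geodesics\<close>

text \<open>Partial derivatives of all orders up to \<open>k\<close> exist and are continuous on the open set \<open>S\<close>.\<close>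

fun C_k_on :: "nat \<Rightarrow> 'a::euclidean_space set \<Rightarrow> ('a \<Rightarrow> 'b::real_normed_vector) \<Rightarrow> bool" where
  "C_k_on 0 S f \<longleftrightarrow> continuous_on S f"
| "C_k_on (Suc k) S f \<longleftrightarrow> (\<forall>x\<in>S. f differentiable (at x))
      \<and> (\<forall>v. C_k_on k S (\<lambda>x. frechet_derivative f (at x) v))"

definition smooth_on :: "'a::euclidean_space set \<Rightarrow> ('a \<Rightarrow> 'b::real_normed_vector) \<Rightarrow> bool"
  where "smooth_on S f \<longleftrightarrow> (\<forall>k. C_k_on k S f)"

definition partial_deriv :: "'n::finite \<Rightarrow> (real ^ 'n \<Rightarrow> real) \<Rightarrow> real ^ 'n \<Rightarrow> real"
  where "partial_deriv i f x = frechet_derivative f (at x) (axis i 1)"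

text \<open>Christoffel symbols \<open>\<Gamma>\<^sup>k\<^sub>i\<^sub>j\<close> of the Levi-Civita connection of the metric \<open>G\<close>.\<close>

definition christoffel ::
  "(real ^ 'n::finite \<Rightarrow> real ^ 'n ^ 'n) \<Rightarrow> real ^ 'n \<Rightarrow> 'n \<Rightarrow> 'n \<Rightarrow> 'n \<Rightarrow> real"
  where "christoffel G x k i j = (1/2) * (\<Sum>l\<in>UNIV. matrix_inv (G x) $ k $ l *
    (partial_deriv i (\<lambda>y. G y $ l $ j) x + partial_deriv j (\<lambda>y. G y $ l $ i) x
      - partial_deriv l (\<lambda>y. G y $ i $ j) x))"

definition geodesic_equation ::
  "(real ^ 'n::finite \<Rightarrow> real ^ 'n ^ 'n) \<Rightarrow> real set \<Rightarrow> (real \<Rightarrow> real ^ 'n) \<Rightarrow> bool"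
  where "geodesic_equation G J u \<longleftrightarrow> (\<exists>u'. \<forall>t\<in>J. (u has_vector_derivative u' t) (at t) \<and>
    (u' has_vector_derivative
      (\<chi> k. - (\<Sum>i\<in>UNIV. \<Sum>j\<in>UNIV. christoffel G (u t) k i j * u' t $ i * u' t $ j))) (at t))"

text \<open>
  Smooth local parametrizations of the quadric by open subsets of \<open>\<real>\<^sup>n\<close>, given through a lift
  \<open>\<Phi>\<close> to homogeneous coordinates: \<open>u \<mapsto> [\<Phi> u]\<close> is an injective immersion into the quadric.  The
  derivative of \<open>u \<mapsto> [\<Phi> u]\<close> kills \<open>v\<close> iff that of \<open>\<Phi>\<close> sends \<open>v\<close> into the line \<open>[\<Phi> u]\<close>.
\<close>

definition local_parametrization ::
  "real ^ ('n::finite option) \<Rightarrow> (real ^ 'n) set \<Rightarrow> (real ^ 'n \<Rightarrow> 'n homog_vec) \<Rightarrow> bool"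
  where "local_parametrization b U \<Phi> \<longleftrightarrow> open U \<and> smooth_on U \<Phi>
    \<and> (\<forall>u\<in>U. \<Phi> u \<noteq> 0 \<and> proj_point (\<Phi> u) \<in> quadric b)
    \<and> inj_on (\<lambda>u. proj_point (\<Phi> u)) U
    \<and> (\<forall>u\<in>U. \<forall>v. frechet_derivative \<Phi> (at u) v \<in> span {\<Phi> u} \<longrightarrow> v = 0)"

definition pullback_metric ::
  "real ^ ('n::finite option) \<Rightarrow> (real ^ 'n \<Rightarrow> 'n homog_vec) \<Rightarrow> real ^ 'n \<Rightarrow> real ^ 'n ^ 'n"
  where "pullback_metric b \<Phi> u = (\<chi> i j. quadric_metric b (\<Phi> u)
    (frechet_derivative \<Phi> (at u) (axis i 1)) (frechet_derivative \<Phi> (at u) (axis j 1)))"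

text \<open>
  Affinely parametrized geodesics of the quadric.  The geodesic equation is invariant under
  changes of coordinates, so it is enough to ask for one local parametrization near each time.
\<close>

definition quadric_geodesic ::
  "real ^ ('n::finite option) \<Rightarrow> real set \<Rightarrow> (real \<Rightarrow> 'n homog_vec set) \<Rightarrow> bool"
  where "quadric_geodesic b I \<gamma> \<longleftrightarrow> (\<forall>t\<^sub>0\<in>I. \<exists>U \<Phi> J u. local_parametrization b U \<Phi>
    \<and> open J \<and> t\<^sub>0 \<in> J \<and> J \<subseteq> I
    \<and> (\<forall>t\<in>J. u t \<in> U \<and> \<gamma> t = proj_point (\<Phi> (u t)))
    \<and> geodesic_equation (pullback_metric b \<Phi>) J u)"

text \<open>
  The square of the velocity of \<open>\<gamma>\<close> at time \<open>t\<close> is \<open>s\<close>.  By \<open>quadric_metric_well_defined\<close> it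
  does not depend on the lift \<open>\<xi>\<close> of \<open>\<gamma>\<close> to homogeneous coordinates.
\<close>

definition has_velocity_square ::
  "real ^ ('n::finite option) \<Rightarrow> (real \<Rightarrow> 'n homog_vec set) \<Rightarrow> real \<Rightarrow> real \<Rightarrow> bool"
  where "has_velocity_square b \<gamma> t s \<longleftrightarrow> (\<exists>\<xi> \<eta>.
    (\<forall>\<^sub>F r in nhds t. \<xi> r \<noteq> 0 \<and> \<gamma> r = proj_point (\<xi> r))
    \<and> (\<xi> has_vector_derivative \<eta>) (at t) \<and> s = quadric_metric b (\<xi> t) \<eta> \<eta>)"

section \<open>The projective Knoerrer map\<close>

text \<open>The image of the line \<open>[\<xi>]\<close> under the linear map \<open>\<xi> \<mapsto> (b\<^sub>0 \<xi>\<^sub>0, \<dots>, b\<^sub>n \<xi>\<^sub>n)\<close>.\<close>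

definition knoerrer_map ::
  "real ^ ('n::finite option) \<Rightarrow> 'n homog_vec set \<Rightarrow> 'n affine_vec set"
  where "knoerrer_map b L = (\<lambda>\<xi>. diag_matrix b *v fst \<xi>) ` L"

lemma knoerrer_map_proj_point:
  "knoerrer_map b (proj_point \<xi>) = proj_point (diag_matrix b *v fst \<xi>)"
  by (auto simp: knoerrer_map_def proj_point_def span_singleton matrix_vector_mult_scaleR image_image)

lemma knoerrer_map_quadric:
  assumes "\<And>i. b $ i \<noteq> 0" "L \<in> quadric b"
  shows "knoerrer_map b L \<in> proj_space"
proof -
  obtain \<xi> where \<xi>: "L = proj_point \<xi>" "\<xi> \<noteq> 0" "quadric_form b \<xi> \<xi> = 0"
    using assms(2) by (auto simp: quadric_def)
  have "diag_matrix b *v fst \<xi> \<noteq> 0"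
  proof
    assume z: "diag_matrix b *v fst \<xi> = 0"
    then have "fst \<xi> = 0"
      using assms(1) by (auto simp: vec_eq_iff diag_matrix_mult_nth)
    moreover have "snd \<xi> = 0"
      using z \<xi>(3) by (simp add: quadric_form_def)
    ultimately show False
      using \<xi>(2) by (simp add: prod_eq_iff)
  qed
  then show ?thesis
    unfolding \<xi>(1) knoerrer_map_proj_point proj_space_def by simp
qed

section \<open>The Neumann system\<close>

definition neumann_solution ::
  "real ^ 'k \<Rightarrow> real \<Rightarrow> real set \<Rightarrow> (real \<Rightarrow> real ^ 'k) \<Rightarrow> (real \<Rightarrow> real ^ 'k) \<Rightarrow> bool"
  where "neumann_solution b \<epsilon> I p q \<longleftrightarrow> (\<forall>t\<in>I. norm (q t) = 1
    \<and> (q has_vector_derivative p t) (at t)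
    \<and> (let \<mu> = \<epsilon> * ((diag_matrix b *v q t) \<bullet> q t) - p t \<bullet> p t in
        (p has_vector_derivative (- \<epsilon> *\<^sub>R (diag_matrix b *v q t) + \<mu> *\<^sub>R q t)) (at t)))"

definition resolvent :: "real ^ 'k \<Rightarrow> real \<Rightarrow> real \<Rightarrow> real ^ 'k ^ 'k"
  where "resolvent b \<epsilon> u = matrix_inv (mat u - \<epsilon> *\<^sub>R diag_matrix b)"

definition Psi :: "real ^ 'k \<Rightarrow> real \<Rightarrow> real \<Rightarrow> real ^ 'k \<Rightarrow> real ^ 'k \<Rightarrow> real"
  where "Psi b \<epsilon> u p q = (1 + (resolvent b \<epsilon> u *v p) \<bullet> p) * ((resolvent b \<epsilon> u *v q) \<bullet> q)
    - ((resolvent b \<epsilon> u *v p) \<bullet> q)\<^sup>2"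

lemma Psi_0:
  assumes "\<And>i. b $ i \<noteq> 0" "\<epsilon> = 1 \<or> \<epsilon> = -1"
  defines "A \<equiv> matrix_inv (diag_matrix b)"
  shows "Psi b \<epsilon> 0 p q = (- \<epsilon> + (A *v p) \<bullet> p) * ((A *v q) \<bullet> q) - ((A *v p) \<bullet> q)\<^sup>2"
proof -
  have D: "diag_matrix x ** diag_matrix y = diag_matrix (x * y)" for x y :: "real ^ 'k"
    by (auto simp: diag_matrix_def matrix_matrix_mult_def vec_eq_iff
        if_distrib [where f = "\<lambda>t. t * _"] cong: if_cong)
  have inv: "matrix_inv (diag_matrix x) = diag_matrix (\<chi> i. inverse (x $ i))"
    if "\<And>i. x $ i \<noteq> 0" for x :: "real ^ 'k"
  proof -
    have "x * (\<chi> i. inverse (x $ i)) = 1" "(\<chi> i. inverse (x $ i)) * x = 1"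
      using that by (auto simp: vec_eq_iff)
    then have I: "diag_matrix x ** diag_matrix (\<chi> i. inverse (x $ i)) = mat 1"
      "diag_matrix (\<chi> i. inverse (x $ i)) ** diag_matrix x = mat 1"
      unfolding D by (simp_all add: diag_matrix_def mat_def vec_eq_iff)
    then have "matrix_inv (diag_matrix x) ** diag_matrix x = mat 1"
      unfolding matrix_inv_def
      using someI [of "\<lambda>A'. diag_matrix x ** A' = mat 1 \<and> A' ** diag_matrix x = mat 1"] by blast
    then show ?thesis
      using I(1) by (metis matrix_mul_assoc matrix_mul_lid matrix_mul_rid)
  qed
  have "mat 0 - \<epsilon> *\<^sub>R diag_matrix b = diag_matrix (- \<epsilon> *\<^sub>R b)"
    by (auto simp: diag_matrix_def mat_def vec_eq_iff)
  then have "resolvent b \<epsilon> 0 = diag_matrix (\<chi> i. inverse ((- \<epsilon> *\<^sub>R b) $ i))"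
    unfolding resolvent_def using assms(1,2) by (subst inv [symmetric]) auto
  also have "\<dots> = - \<epsilon> *\<^sub>R A"
    unfolding A_def inv [OF assms(1)] using assms(2) by (auto simp: diag_matrix_def vec_eq_iff)
  finally have r: "resolvent b \<epsilon> 0 *v v = - \<epsilon> *\<^sub>R (A *v v)" for v
    by (simp add: scaleR_matrix_vector_assoc)
  show ?thesis
    unfolding Psi_def r using assms(2) by (auto simp: algebra_simps)
qed

end

theory Submission
  imports Defs
begin

text \<open>
  Normalize homogeneous lifts by \<open>|Bx| = 1\<close>, where \<open>\<xi> = (x, z)\<close>.  On normalized lifts the metric of
  the quadric is the restriction of the constant form \<open>Q(\<xi>, \<xi>) = (Bx, x) - z\<^sup>2\<close>, so a curve of
  normalized lifts is a geodesic iff \<open>\<xi>''\<close> is \<open>Q\<close>-orthogonal to \<open>{Q(\<xi>, \<xi>) = 0, |Bx| = 1}\<close>, that is,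
  iff \<open>\<xi>'' = \<alpha> \<xi> + \<beta> (Bx, 0)\<close>.  Differentiating \<open>Q(\<xi>, \<xi>) = 0\<close> twice gives
  \<open>\<beta> = - Q(\<xi>', \<xi>') = - \<epsilon>\<close>, and applying \<open>B\<close> to the first component gives the Neumann
  equation for \<open>q = Bx\<close>, with \<open>\<alpha>\<close> as the multiplier of \<open>|q| = 1\<close>.  Finally
  \<open>(Aq, q) = z\<^sup>2\<close>, \<open>(Ap, q) = z z'\<close> and \<open>(Ap, p) = \<epsilon> + z'\<^sup>2\<close>, which makes \<open>\<Psi>\<^sub>0\<close> vanish.
  The sign of the local unit lifts is chosen consistently over the interval by covering theory.
\<close>

section \<open>Symmetry of second derivatives\<close>

text \<open>The mean value theorem is applied twice, first along v to the increment of f in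
  direction w, then along w to the derivative in direction v. The left-hand side is symmetric in v
  and w while the right-hand side is not, which is what makes it useful.\<close>

lemma second_difference_mean_value:
  fixes f :: "'a::real_normed_vector \<Rightarrow> real"
  assumes s: "0 < s"
    and mem: "\<And>\<sigma> \<tau>. \<lbrakk>0 \<le> \<sigma>; \<sigma> \<le> s; 0 \<le> \<tau>; \<tau> \<le> s\<rbrakk> \<Longrightarrow> x + \<sigma> *\<^sub>R v + \<tau> *\<^sub>R w \<in> S"
    and D: "\<And>y. y \<in> S \<Longrightarrow> (f has_derivative D y) (at y)"
    and D2: "\<And>y. y \<in> S \<Longrightarrow> ((\<lambda>z. D z v) has_derivative D2 y) (at y)"
  obtains \<sigma> \<tau> where "0 < \<sigma>" "\<sigma> < s" "0 < \<tau>" "\<tau> < s"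
    "f (x + s *\<^sub>R v + s *\<^sub>R w) - f (x + s *\<^sub>R v) - f (x + s *\<^sub>R w) + f x
      = s\<^sup>2 * D2 (x + \<sigma> *\<^sub>R v + \<tau> *\<^sub>R w) w"
proof -
  \<comment> \<open>The increment of f across a parallelogram of sides s v and s w, as a function of
    the position \<sigma> along v. Its total change is the second difference.\<close>
  define g where "g \<sigma> = f (x + \<sigma> *\<^sub>R v + s *\<^sub>R w) - f (x + \<sigma> *\<^sub>R v)" for \<sigma>
  define g' where "g' \<sigma> = D (x + \<sigma> *\<^sub>R v + s *\<^sub>R w) v - D (x + \<sigma> *\<^sub>R v) v" for \<sigma>
  have g: "(g has_real_derivative g' \<sigma>) (at \<sigma>)" if "0 \<le> \<sigma>" "\<sigma> \<le> s" for \<sigma>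
  proof -
    have line: "((\<lambda>\<sigma>. f (x + \<sigma> *\<^sub>R v + \<tau> *\<^sub>R w)) has_real_derivative
        D (x + \<sigma> *\<^sub>R v + \<tau> *\<^sub>R w) v) (at \<sigma>)" if "0 \<le> \<tau>" "\<tau> \<le> s" for \<tau>
    proof -
      have Dy: "(f has_derivative D (x + \<sigma> *\<^sub>R v + \<tau> *\<^sub>R w)) (at (x + \<sigma> *\<^sub>R v + \<tau> *\<^sub>R w))"
        using D mem \<open>0 \<le> \<sigma>\<close> \<open>\<sigma> \<le> s\<close> that by blast
      have "((\<lambda>\<sigma>. x + \<sigma> *\<^sub>R v + \<tau> *\<^sub>R w) has_derivative (\<lambda>h. h *\<^sub>R v)) (at \<sigma>)"
        by (auto intro!: derivative_eq_intros)
      from has_derivative_compose [OF this Dy] show ?thesis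
        by (rule has_derivative_imp_has_field_derivative)
          (simp add: linear_cmul [OF has_derivative_linear [OF Dy]])
    qed
    show ?thesis
      unfolding g_def [abs_def] g'_def using line [of s] line [of 0] s
      by (auto intro!: derivative_eq_intros)
  qed
  obtain \<sigma> where \<sigma>: "0 < \<sigma>" "\<sigma> < s" "g s - g 0 = s * g' \<sigma>"
    using MVT2 [OF s, of g g'] g by auto
  \<comment> \<open>With \<sigma> fixed, the difference in \<open>g'\<close> is the change of the
    v-derivative along w, to which the mean value theorem applies again.\<close>
  define k where "k \<tau> = D (x + \<sigma> *\<^sub>R v + \<tau> *\<^sub>R w) v" for \<tau>
  have k: "(k has_real_derivative D2 (x + \<sigma> *\<^sub>R v + \<tau> *\<^sub>R w) w) (at \<tau>)"
    if "0 \<le> \<tau>" "\<tau> \<le> s" for \<tau>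
  proof -
    have Dy: "((\<lambda>z. D z v) has_derivative D2 (x + \<sigma> *\<^sub>R v + \<tau> *\<^sub>R w)) (at (x + \<sigma> *\<^sub>R v + \<tau> *\<^sub>R w))"
      using D2 mem \<sigma> that by simp
    have "((\<lambda>\<tau>. x + \<sigma> *\<^sub>R v + \<tau> *\<^sub>R w) has_derivative (\<lambda>h. h *\<^sub>R w)) (at \<tau>)"
      by (auto intro!: derivative_eq_intros)
    from has_derivative_compose [OF this Dy] show ?thesis
      unfolding k_def
      by (rule has_derivative_imp_has_field_derivative)
        (simp add: linear_cmul [OF has_derivative_linear [OF Dy]])
  qed
  obtain \<tau> where \<tau>: "0 < \<tau>" "\<tau> < s" "k s - k 0 = s * D2 (x + \<sigma> *\<^sub>R v + \<tau> *\<^sub>R w) w"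
    using MVT2 [OF s, of k "\<lambda>\<tau>. D2 (x + \<sigma> *\<^sub>R v + \<tau> *\<^sub>R w) w"] k by auto
  show thesis
  proof (rule that [OF \<sigma>(1,2) \<tau>(1,2)])
    have "g' \<sigma> = k s - k 0"
      by (simp add: g'_def k_def)
    then show "f (x + s *\<^sub>R v + s *\<^sub>R w) - f (x + s *\<^sub>R v) - f (x + s *\<^sub>R w) + f x
      = s\<^sup>2 * D2 (x + \<sigma> *\<^sub>R v + \<tau> *\<^sub>R w) w"
      using \<sigma>(3) \<tau>(3) by (simp add: g_def power2_eq_square)
  qed
qed

text \<open>The symmetric second difference, divided by the square of s, is a value of either mixed
  derivative at some point near x. Continuity at x then excludes a gap between the two.\<close>

lemma mixed_derivatives_commute:
  fixes f :: "'a::real_normed_vector \<Rightarrow> real"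
  assumes S: "open S" "x \<in> S"
    and D: "\<And>y. y \<in> S \<Longrightarrow> (f has_derivative D y) (at y)"
    and V: "\<And>y. y \<in> S \<Longrightarrow> ((\<lambda>z. D z v) has_derivative V y) (at y)"
    and W: "\<And>y. y \<in> S \<Longrightarrow> ((\<lambda>z. D z w) has_derivative W y) (at y)"
    and cont: "continuous_on S (\<lambda>y. V y w)" "continuous_on S (\<lambda>y. W y v)"
  shows "V x w = W x v"
proof (rule ccontr)
  assume ne: "V x w \<noteq> W x v"
  \<comment> \<open>Half the gap: two equal values strictly within e of the two limits would force
    the gap to be below 2 e.\<close>
  define e where "e = \<bar>V x w - W x v\<bar> / 2"
  have e: "e > 0"
    using ne by (simp add: e_def)
  obtain r0 where r0: "r0 > 0" "ball x r0 \<subseteq> S"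
    using S openE by blast
  obtain r1 where r1: "r1 > 0" "\<And>y. y \<in> S \<Longrightarrow> dist y x < r1 \<Longrightarrow> dist (V y w) (V x w) < e"
    using cont(1) S(2) e unfolding continuous_on_iff by metis
  obtain r2 where r2: "r2 > 0" "\<And>y. y \<in> S \<Longrightarrow> dist y x < r2 \<Longrightarrow> dist (W y v) (W x v) < e"
    using cont(2) S(2) e unfolding continuous_on_iff by metis
  define r where "r = min r0 (min r1 r2)"
  \<comment> \<open>Small enough for the whole parallelogram to stay within distance r of x; the
    summand 1 keeps the denominator positive when v and w vanish.\<close>
  define s where "s = r / (2 * (norm v + norm w + 1))"
  have r: "r > 0"
    using r0 r1 r2 by (simp add: r_def)
  have N: "norm v + norm w + 1 > 0"
    by (simp add: add_nonneg_pos)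
  have s: "s > 0"
    using r N by (simp add: s_def)
  have near: "dist (x + \<sigma> *\<^sub>R v + \<tau> *\<^sub>R w) x < r"
    if "0 \<le> \<sigma>" "\<sigma> \<le> s" "0 \<le> \<tau>" "\<tau> \<le> s" for \<sigma> \<tau>
  proof -
    have "dist (x + \<sigma> *\<^sub>R v + \<tau> *\<^sub>R w) x = norm (\<sigma> *\<^sub>R v + \<tau> *\<^sub>R w)"
      by (simp add: dist_norm)
    also have "\<dots> \<le> \<sigma> * norm v + \<tau> * norm w"
      using norm_triangle_ineq [of "\<sigma> *\<^sub>R v" "\<tau> *\<^sub>R w"] that by simp
    also have "\<dots> \<le> s * norm v + s * norm w"
      using that by (intro add_mono mult_right_mono) auto
    also have "\<dots> \<le> s * (norm v + norm w + 1)"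
      using s by (simp add: algebra_simps)
    also have "\<dots> = r / 2"
    proof -
      have "r / (2 * k) * k = r / 2" if "k > 0" for k
        using that by simp
      then show ?thesis
        unfolding s_def using N by blast
    qed
    finally show ?thesis
      using r by simp
  qed
  have mem: "x + \<sigma> *\<^sub>R v + \<tau> *\<^sub>R w \<in> S"
    if "0 \<le> \<sigma>" "\<sigma> \<le> s" "0 \<le> \<tau>" "\<tau> \<le> s" for \<sigma> \<tau>
    using near [OF that] r0(2) by (auto simp: r_def dist_commute subset_eq)
  have mem': "x + \<tau> *\<^sub>R w + \<sigma> *\<^sub>R v \<in> S" "dist (x + \<tau> *\<^sub>R w + \<sigma> *\<^sub>R v) x < r"
    if "0 \<le> \<tau>" "\<tau> \<le> s" "0 \<le> \<sigma>" "\<sigma> \<le> s" for \<sigma> \<tau>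
    using mem [of \<sigma> \<tau>] near [of \<sigma> \<tau>] that by (simp_all add: add_ac)
  obtain \<sigma> \<tau> where 1: "0 < \<sigma>" "\<sigma> < s" "0 < \<tau>" "\<tau> < s"
    "f (x + s *\<^sub>R v + s *\<^sub>R w) - f (x + s *\<^sub>R v) - f (x + s *\<^sub>R w) + f x
      = s\<^sup>2 * V (x + \<sigma> *\<^sub>R v + \<tau> *\<^sub>R w) w"
    using second_difference_mean_value [OF s mem D V] by blast
  obtain \<tau>' \<sigma>' where 2: "0 < \<tau>'" "\<tau>' < s" "0 < \<sigma>'" "\<sigma>' < s"
    "f (x + s *\<^sub>R w + s *\<^sub>R v) - f (x + s *\<^sub>R w) - f (x + s *\<^sub>R v) + f x
      = s\<^sup>2 * W (x + \<tau>' *\<^sub>R w + \<sigma>' *\<^sub>R v) v"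
    using second_difference_mean_value [OF s mem'(1) D W] by blast
  have "s\<^sup>2 * V (x + \<sigma> *\<^sub>R v + \<tau> *\<^sub>R w) w = s\<^sup>2 * W (x + \<tau>' *\<^sub>R w + \<sigma>' *\<^sub>R v) v"
  proof -
    have "x + s *\<^sub>R w + s *\<^sub>R v = x + s *\<^sub>R v + s *\<^sub>R w"
      by (simp add: add_ac)
    with 2(5) have "f (x + s *\<^sub>R v + s *\<^sub>R w) - f (x + s *\<^sub>R w) - f (x + s *\<^sub>R v) + f x
      = s\<^sup>2 * W (x + \<tau>' *\<^sub>R w + \<sigma>' *\<^sub>R v) v"
      by simp
    with 1(5) show ?thesis
      by linarith
  qed
  then have "V (x + \<sigma> *\<^sub>R v + \<tau> *\<^sub>R w) w = W (x + \<tau>' *\<^sub>R w + \<sigma>' *\<^sub>R v) v"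
    using s by simp
  moreover have "dist (V (x + \<sigma> *\<^sub>R v + \<tau> *\<^sub>R w) w) (V x w) < e"
    using r1(2) [OF mem] near 1 by (simp add: r_def)
  moreover have "dist (W (x + \<tau>' *\<^sub>R w + \<sigma>' *\<^sub>R v) v) (W x v) < e"
    using r2(2) [OF mem'(1)] mem'(2) 2 by (simp add: r_def)
  moreover have "\<bar>V x w - W x v\<bar> = 2 * e"
    by (simp add: e_def)
  ultimately show False
    unfolding dist_real_def by linarith
qed

text \<open>Pairing with a fixed vector reduces to real-valued functions, where the mean value
  theorem is available.\<close>

lemma C_k_on_second_derivatives_commute:
  fixes f :: "'a::euclidean_space \<Rightarrow> 'b::real_inner"
  assumes f: "C_k_on (Suc (Suc 0)) S f" and S: "open S" "x \<in> S"
  shows "frechet_derivative (\<lambda>y. frechet_derivative f (at y) v) (at x) w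
    = frechet_derivative (\<lambda>y. frechet_derivative f (at y) w) (at x) v"
proof -
  have D: "(f has_derivative frechet_derivative f (at y)) (at y)" if "y \<in> S" for y
    using f that by (simp add: frechet_derivative_works)
  have D2: "((\<lambda>z. frechet_derivative f (at z) v) has_derivative
      frechet_derivative (\<lambda>z. frechet_derivative f (at z) v) (at y)) (at y)" if "y \<in> S" for y v
    using f that by (simp add: frechet_derivative_works)
  have cont: "continuous_on S (\<lambda>y. frechet_derivative (\<lambda>z. frechet_derivative f (at z) v) (at y) w)"
    for v w
    using f by simp
  have "frechet_derivative (\<lambda>y. frechet_derivative f (at y) v) (at x) w \<bullet> z
    = frechet_derivative (\<lambda>y. frechet_derivative f (at y) w) (at x) v \<bullet> z" for z
    by (rule mixed_derivatives_commute [OF S, where f = "\<lambda>y. f y \<bullet> z"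
        and D = "\<lambda>y h. frechet_derivative f (at y) h \<bullet> z"])
      (auto intro!: has_derivative_inner_left D D2 continuous_intros cont)
  then show ?thesis
    using vector_eq_rdot by blast
qed

section \<open>Unit lifts of curves of lines\<close>

lemma span_singleton_scaleR:
  fixes v :: "'a::real_vector"
  assumes "c \<noteq> 0"
  shows "span {c *\<^sub>R v} = span {v}"
proof (rule span_eq [THEN iffD2], intro conjI)
  show "{c *\<^sub>R v} \<subseteq> span {v}"
    by (simp add: span_base span_scale)
  have "inverse c *\<^sub>R c *\<^sub>R v \<in> span {c *\<^sub>R v}"
    by (simp only: span_base span_scale singleton_iff)
  then show "{v} \<subseteq> span {c *\<^sub>R v}"
    using assms by simp
qed

text \<open>
  The unit vectors in the lines \<open>L t\<close> form a two-sheeted covering of the interval, and the identity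
  of the interval lifts to it.
\<close>

lemma continuous_unit_lift:
  fixes L :: "real \<Rightarrow> 'a::euclidean_space set"
  assumes I: "open I" "is_interval I"
    and loc: "\<And>t. t \<in> I \<Longrightarrow> \<exists>J f. open J \<and> t \<in> J \<and> J \<subseteq> I \<and> continuous_on J f
      \<and> (\<forall>s\<in>J. norm (f s) = 1 \<and> L s = span {f s})"
  obtains q where "continuous_on I q" "\<And>t. t \<in> I \<Longrightarrow> norm (q t) = 1 \<and> L t = span {q t}"
proof -
  \<comment> \<open>The total space of the covering: all unit vectors of the lines, with
    \<open>fst\<close> as projection.\<close>
  define C where "C = {(t, v). t \<in> I \<and> v \<in> L t \<and> norm v = 1}"
  have cov: "covering_space C fst I"
    unfolding covering_space_def
  proof (intro conjI ballI)
    show "continuous_on C fst"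
      by (intro continuous_intros)
    show "fst ` C = I"
    proof
      show "I \<subseteq> fst ` C"
      proof
        fix t assume "t \<in> I"
        then obtain f where "norm (f t) = 1" "L t = span {f t}"
          using loc [of t] by blast
        then have "(t, f t) \<in> C"
          using \<open>t \<in> I\<close> by (simp add: C_def span_base)
        then show "t \<in> fst ` C"
          by force
      qed
    qed (auto simp: C_def)
    fix t assume "t \<in> I"
    then obtain J f where J: "open J" "t \<in> J" "J \<subseteq> I" and f: "continuous_on J f"
      and nf: "\<And>s. s \<in> J \<Longrightarrow> norm (f s) = 1" and Lf: "\<And>s. s \<in> J \<Longrightarrow> L s = span {f s}"
      using loc by metis
    \<comment> \<open>Over J the two sheets are the graphs of f and of -f, for c = 1 and c =
      -1.\<close>
    define sheet where "sheet c = (\<lambda>s. (s, c *\<^sub>R f s)) ` J" for c :: real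
    have CJ: "(s, v) \<in> C \<longleftrightarrow> v = f s \<or> v = - f s" if "s \<in> J" for s v
    proof -
      have "(s, v) \<in> C \<longleftrightarrow> (\<exists>c. v = c *\<^sub>R f s) \<and> norm v = 1"
        using that J Lf by (auto simp: C_def span_singleton)
      also have "\<dots> \<longleftrightarrow> (\<exists>c. v = c *\<^sub>R f s \<and> \<bar>c\<bar> = 1)"
        using nf [OF that] by auto
      also have "\<dots> \<longleftrightarrow> v = f s \<or> v = - f s"
      proof
        assume "\<exists>c. v = c *\<^sub>R f s \<and> \<bar>c\<bar> = 1"
        then obtain c where "v = c *\<^sub>R f s" "c = 1 \<or> c = -1"
          by (auto simp: abs_if split: if_splits)
        then show "v = f s \<or> v = - f s"
          by auto
      next
        assume "v = f s \<or> v = - f s"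
        then have "v = 1 *\<^sub>R f s \<or> v = (-1) *\<^sub>R f s"
          by simp
        then show "\<exists>c. v = c *\<^sub>R f s \<and> \<bar>c\<bar> = 1"
          by (metis abs_minus_cancel abs_one)
      qed
      finally show ?thesis .
    qed
    have ff: "f s \<bullet> f s = 1" if "s \<in> J" for s
      using nf [OF that] by (simp add: norm_eq_1)
    \<comment> \<open>Over J, membership in a sheet is a strict inequality in a continuous function;
      this yields both openness and disjointness of the sheets.\<close>
    have sheet_eq: "sheet c = {z \<in> C \<inter> J \<times> UNIV. c * (snd z \<bullet> f (fst z)) \<in> {0<..}}"
      if "c = 1 \<or> c = -1" for c
      unfolding sheet_def using that CJ ff by (auto simp: image_iff)
    have opn: "openin (top_of_set C) (sheet c)" if "c = 1 \<or> c = -1" for c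
    proof -
      have "continuous_on (C \<inter> J \<times> UNIV) (\<lambda>z. f (fst z))"
        by (rule continuous_on_compose2 [OF f]) (auto intro: continuous_intros)
      then have "continuous_on (C \<inter> J \<times> UNIV) (\<lambda>z. c * (snd z \<bullet> f (fst z)))"
        by (intro continuous_intros)
      then have "openin (top_of_set (C \<inter> J \<times> UNIV))
          ((C \<inter> J \<times> UNIV) \<inter> (\<lambda>z. c * (snd z \<bullet> f (fst z))) -` {0<..})"
        by (rule continuous_openin_preimage_gen) simp
      moreover have "sheet c = (C \<inter> J \<times> UNIV) \<inter> (\<lambda>z. c * (snd z \<bullet> f (fst z))) -` {0<..}"
        unfolding sheet_eq [OF that] by auto
      ultimately have "openin (top_of_set (C \<inter> J \<times> UNIV)) (sheet c)"
        by simp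
      moreover have "openin (top_of_set C) (C \<inter> J \<times> UNIV)"
        using J by (intro openin_open_Int open_Times) auto
      ultimately show ?thesis
        using openin_trans by blast
    qed
    have hom: "homeomorphism (sheet c) J fst (\<lambda>s. (s, c *\<^sub>R f s))" for c
      by (rule homeomorphismI) (auto simp: sheet_def intro!: continuous_intros f)
    show "\<exists>T. t \<in> T \<and> openin (top_of_set I) T \<and> (\<exists>v. \<Union> v = C \<inter> fst -` T
        \<and> (\<forall>u\<in>v. openin (top_of_set C) u) \<and> pairwise disjnt v
        \<and> (\<forall>u\<in>v. \<exists>q. homeomorphism u T fst q))"
    proof (intro exI conjI)
      show "t \<in> J" "openin (top_of_set I) J"
        using J by (auto simp: openin_open_eq I)
      show "\<Union> {sheet 1, sheet (-1)} = C \<inter> fst -` J"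
        using CJ by (auto simp: sheet_def image_iff)
      show "\<forall>u\<in>{sheet 1, sheet (-1)}. openin (top_of_set C) u"
        using opn by auto
      show "pairwise disjnt {sheet 1, sheet (-1)}"
        by (auto simp: pairwise_def disjnt_iff sheet_eq)
      show "\<forall>u\<in>{sheet 1, sheet (-1)}. \<exists>q. homeomorphism u J fst q"
        using hom by blast
    qed
  qed
  \<comment> \<open>An interval is simply connected and locally path connected, so its identity map
    lifts to a continuous section of the covering.\<close>
  have "convex I"
    using I(2) by (simp add: is_interval_convex)
  then have "simply_connected I" "locally path_connected I"
    by (simp_all add: convex_imp_simply_connected convex_imp_locally_path_connected)
  then obtain g where g: "continuous_on I g" "g \<in> I \<rightarrow> C" "\<And>t. t \<in> I \<Longrightarrow> fst (g t) = t"
    using covering_space_lift [OF cov _ _ continuous_on_id] by (metis Pi_I)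
  show thesis
  proof
    show "continuous_on I (snd \<circ> g)"
      using g(1) by (auto intro!: continuous_intros)
    fix t assume t: "t \<in> I"
    have "g t \<in> C"
      using g(2) t by auto
    then have "(snd \<circ> g) t \<in> L t" and n: "norm ((snd \<circ> g) t) = 1"
      using g(3) [OF t] by (auto simp: C_def)
    moreover obtain f where f: "L t = span {f t}"
      using loc [OF t] by blast
    ultimately obtain c where c: "(snd \<circ> g) t = c *\<^sub>R f t"
      by (auto simp: span_singleton)
    with n have "c \<noteq> 0"
      by auto
    then have "L t = span {(snd \<circ> g) t}"
      unfolding f c by (rule span_singleton_scaleR [symmetric])
    with n show "norm ((snd \<circ> g) t) = 1 \<and> L t = span {(snd \<circ> g) t}"
      by simp
  qed
qed

section \<open>Geodesics of the quadric\<close>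

lemma bounded_bilinear_quadric_form: "bounded_bilinear (quadric_form b)"
  unfolding bilinear_conv_bounded_bilinear [symmetric] bilinear_def
  by (intro conjI allI linearI) (simp_all only: quadric_form_lin real_scaleR_def)

lemma bounded_linear_diag_fst:
  "bounded_linear (\<lambda>\<xi> :: ('n::finite) homog_vec. diag_matrix b *v fst \<xi>)"
  by (rule bounded_linear_compose [OF matrix_vector_mul_bounded_linear bounded_linear_fst])

lemma diag_matrix_self_adjoint: "(diag_matrix b *v x) \<bullet> y = x \<bullet> (diag_matrix b *v y)"
  by (simp add: inner_vec_def diag_matrix_mult_nth mult_ac)

lemma proj_point_in_quadric:
  assumes "proj_point \<xi> \<in> quadric b"
  shows "quadric_form b \<xi> \<xi> = 0"
proof -
  obtain \<zeta> where \<zeta>: "span {\<xi>} = span {\<zeta>}" "quadric_form b \<zeta> \<zeta> = 0"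
    using assms by (auto simp: quadric_def proj_point_def)
  have "\<xi> \<in> span {\<zeta>}"
    using \<zeta>(1) span_base by blast
  with \<zeta>(2) show ?thesis
    by (auto simp: span_singleton quadric_form_lin)
qed

section \<open>Lowering the index in the geodesic equation\<close>

lemma sum_axis_linear:
  fixes f :: "real ^ 'n::finite \<Rightarrow> 'b::real_vector"
  assumes "linear f"
  shows "(\<Sum>i\<in>UNIV. x $ i *\<^sub>R f (axis i 1)) = f x"
proof -
  have "f x = f (\<Sum>i\<in>UNIV. x $ i *\<^sub>R axis i 1)"
    by (simp add: basis_expansion flip: scalar_mult_eq_scaleR)
  also have "\<dots> = (\<Sum>i\<in>UNIV. x $ i *\<^sub>R f (axis i 1))"
    using assms by (simp add: linear_sum linear_cmul)
  finally show ?thesis ..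
qed

text \<open>Multiplication by G cancels the inverse matrix in the Christoffel symbols. After
  contraction with v twice, two of the three derivative terms coincide by exchanging i and
  j.\<close>

lemma geodesic_acceleration:
  fixes G :: "real ^ 'n::finite \<Rightarrow> real ^ 'n ^ 'n" and v :: "real ^ 'n"
  assumes "invertible (G x)"
  defines "a \<equiv> \<chi> k. - (\<Sum>i\<in>UNIV. \<Sum>j\<in>UNIV. christoffel G x k i j * v $ i * v $ j)"
  shows "(G x *v a) $ l = (\<Sum>i\<in>UNIV. \<Sum>j\<in>UNIV.
    (1/2 * partial_deriv l (\<lambda>y. G y $ i $ j) x - partial_deriv i (\<lambda>y. G y $ l $ j) x) * v $ i * v $ j)"
proof -
  define c where "c = (\<chi> l. \<Sum>i\<in>UNIV. \<Sum>j\<in>UNIV.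
    (1/2 * (partial_deriv i (\<lambda>y. G y $ l $ j) x + partial_deriv j (\<lambda>y. G y $ l $ i) x
      - partial_deriv l (\<lambda>y. G y $ i $ j) x)) * v $ i * v $ j)"
  have "a = - (matrix_inv (G x) *v c)"
  proof (subst vec_eq_iff, intro allI)
    fix k
    have "(matrix_inv (G x) *v c) $ k = (\<Sum>m\<in>UNIV. \<Sum>i\<in>UNIV. \<Sum>j\<in>UNIV.
      matrix_inv (G x) $ k $ m * ((1/2 * (partial_deriv i (\<lambda>y. G y $ m $ j) x
        + partial_deriv j (\<lambda>y. G y $ m $ i) x - partial_deriv m (\<lambda>y. G y $ i $ j) x)) * v $ i * v $ j))"
      by (simp add: matrix_vector_mult_def c_def sum_distrib_left)
    also have "\<dots> = (\<Sum>i\<in>UNIV. \<Sum>j\<in>UNIV. \<Sum>m\<in>UNIV.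
      matrix_inv (G x) $ k $ m * ((1/2 * (partial_deriv i (\<lambda>y. G y $ m $ j) x
        + partial_deriv j (\<lambda>y. G y $ m $ i) x - partial_deriv m (\<lambda>y. G y $ i $ j) x)) * v $ i * v $ j))"
      by (subst sum.swap, rule sum.cong [OF refl], rule sum.swap)
    also have "\<dots> = (\<Sum>i\<in>UNIV. \<Sum>j\<in>UNIV. christoffel G x k i j * v $ i * v $ j)"
      unfolding christoffel_def sum_distrib_left sum_distrib_right
      by (intro sum.cong refl) (simp add: mult_ac)
    finally show "a $ k = (- (matrix_inv (G x) *v c)) $ k"
      by (simp add: a_def)
  qed
  \<comment> \<open>\<open>matrix_inv\<close> is defined by choice; invertibility makes the chosen
    matrix a genuine inverse.\<close>
  moreover have "G x ** matrix_inv (G x) = mat 1"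
    using assms(1) someI_ex [of "\<lambda>A'. G x ** A' = mat 1 \<and> A' ** G x = mat 1"]
    by (auto simp: invertible_def matrix_inv_def)
  ultimately have "G x *v a = - c"
    by (simp add: matrix_vector_mul_assoc vec.neg)
  moreover have "(\<Sum>i\<in>UNIV. \<Sum>j\<in>UNIV. partial_deriv j (\<lambda>y. G y $ l $ i) x * v $ i * v $ j)
    = (\<Sum>i\<in>UNIV. \<Sum>j\<in>UNIV. partial_deriv i (\<lambda>y. G y $ l $ j) x * v $ i * v $ j)"
    by (subst sum.swap) (simp add: mult_ac)
  ultimately show ?thesis
    by (simp add: c_def algebra_simps sum.distrib sum_subtractf add_divide_distrib diff_divide_distrib
        flip: sum_divide_distrib)
qed

text \<open>Two lifts differ by a differentiable scalar factor c, so their velocities differ by the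
  factor c and a multiple of the point, which the metric does not see. This allows the velocity
  square, stated for some unknown lift, to be computed on the lift coming from a
  parametrization.\<close>

lemma quadric_metric_lift_independent:
  fixes b :: "real ^ ('n::finite option)"
  assumes b: "\<And>i. b $ i \<noteq> 0"
    and \<xi>: "\<forall>\<^sub>F r in nhds t. \<xi> r \<noteq> 0 \<and> \<gamma> r = proj_point (\<xi> r)" "(\<xi> has_vector_derivative \<xi>') (at t)"
    and \<eta>: "\<forall>\<^sub>F r in nhds t. \<eta> r \<noteq> 0 \<and> \<gamma> r = proj_point (\<eta> r)" "(\<eta> has_vector_derivative \<eta>') (at t)"
    and Q: "quadric_form b (\<eta> t) (\<eta> t) = 0" "quadric_form b (\<eta> t) \<eta>' = 0"
  shows "quadric_metric b (\<xi> t) \<xi>' \<xi>' = quadric_metric b (\<eta> t) \<eta>' \<eta>'"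
proof -
  \<comment> \<open>The explicit quotient provides differentiability of the factor, which pointwise
    existence would not.\<close>
  define c where "c r = (\<xi> r \<bullet> \<eta> r) / (\<eta> r \<bullet> \<eta> r)" for r
  have ev: "\<forall>\<^sub>F r in nhds t. \<xi> r = c r *\<^sub>R \<eta> r"
    using \<xi>(1) \<eta>(1)
  proof eventually_elim
    case (elim r)
    then have "\<xi> r \<in> span {\<eta> r}"
      using span_base [of "\<xi> r" "{\<xi> r}"] by (simp add: proj_point_def)
    then obtain k where "\<xi> r = k *\<^sub>R \<eta> r"
      by (auto simp: span_singleton)
    with elim show ?case
      by (simp add: c_def)
  qed
  have nz: "\<xi> t \<noteq> 0" "\<eta> t \<noteq> 0"
    using eventually_nhds_x_imp_x [OF \<xi>(1)] eventually_nhds_x_imp_x [OF \<eta>(1)] by auto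
  have eq: "\<xi> t = c t *\<^sub>R \<eta> t"
    using eventually_nhds_x_imp_x [OF ev] .
  have inner: "((\<lambda>r. f r \<bullet> g r) has_real_derivative f t \<bullet> g' + f' \<bullet> g t) (at t)"
    if "(f has_vector_derivative f') (at t)" "(g has_vector_derivative g') (at t)"
    for f g :: "real \<Rightarrow> 'n homog_vec" and f' g'
    unfolding has_real_derivative_iff_has_vector_derivative
    by (rule bounded_bilinear.has_vector_derivative [OF bounded_bilinear_inner that])
  obtain c' where c': "(c has_real_derivative c') (at t)"
    unfolding c_def [abs_def]
    using DERIV_divide [OF inner [OF \<xi>(2) \<eta>(2)] inner [OF \<eta>(2) \<eta>(2)]] nz by force
  have "((\<lambda>r. c r *\<^sub>R \<eta> r) has_vector_derivative c t *\<^sub>R \<eta>' + c' *\<^sub>R \<eta> t) (at t)"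
    using c' \<eta>(2) by (rule has_vector_derivative_scaleR)
  moreover obtain S where "open S" "t \<in> S" "\<And>r. r \<in> S \<Longrightarrow> \<xi> r = c r *\<^sub>R \<eta> r"
    using ev unfolding eventually_nhds by blast
  ultimately have "(\<xi> has_vector_derivative c t *\<^sub>R \<eta>' + c' *\<^sub>R \<eta> t) (at t)"
    by (auto intro: has_vector_derivative_transform_within_open)
  then have "\<xi>' = c t *\<^sub>R \<eta>' + c' *\<^sub>R \<eta> t"
    using \<xi>(2) vector_derivative_unique_at by blast
  then show ?thesis
    unfolding eq using nz eq Q
    by (simp add: quadric_metric_well_defined quadric_tangent_def)
qed

section \<open>The constant form Q along one local parametrization\<close>

locale quadric_chart =
  fixes b :: "real ^ ('n::finite option)" and U :: "(real ^ 'n) set"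
    and \<Phi> :: "real ^ 'n \<Rightarrow> 'n homog_vec"
  assumes b_nonzero: "\<And>i. b $ i \<noteq> 0"
    and param: "local_parametrization b U \<Phi>"
begin

abbreviation "Q \<equiv> quadric_form b"
abbreviation "B \<xi> \<equiv> diag_matrix b *v fst \<xi>"
abbreviation "D x \<equiv> frechet_derivative \<Phi> (at x)"
abbreviation "D2 x v \<equiv> frechet_derivative (\<lambda>y. D y v) (at x)"

text \<open>The conformal factor between Q and the metric of the quadric along \<Phi>.\<close>

definition weight :: "real ^ 'n \<Rightarrow> real"
  where "weight x = 1 / (B (\<Phi> x) \<bullet> B (\<Phi> x))"

definition weight_deriv :: "real ^ 'n \<Rightarrow> real ^ 'n \<Rightarrow> real"
  where "weight_deriv x v = - 2 * (weight x)\<^sup>2 * (B (\<Phi> x) \<bullet> B (D x v))"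

lemma open_U: "open U"
  and \<Phi>_nonzero: "x \<in> U \<Longrightarrow> \<Phi> x \<noteq> 0"
  and Q_\<Phi>: "x \<in> U \<Longrightarrow> Q (\<Phi> x) (\<Phi> x) = 0"
  and immersion: "x \<in> U \<Longrightarrow> D x v \<in> span {\<Phi> x} \<Longrightarrow> v = 0"
  using param proj_point_in_quadric unfolding local_parametrization_def by blast+

lemma C2: "C_k_on (Suc (Suc 0)) U \<Phi>"
  using param unfolding local_parametrization_def smooth_on_def by blast

lemma D: "x \<in> U \<Longrightarrow> (\<Phi> has_derivative D x) (at x)"
  and D2: "x \<in> U \<Longrightarrow> ((\<lambda>y. D y v) has_derivative D2 x v) (at x)"
  using C2 by (simp_all add: frechet_derivative_works)

lemma D2_sym: "x \<in> U \<Longrightarrow> D2 x v w = D2 x w v"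
  using C_k_on_second_derivatives_commute [OF C2 open_U] .

lemma linear_D: "x \<in> U \<Longrightarrow> linear (D x)"
  and linear_D2: "x \<in> U \<Longrightarrow> linear (D2 x v)"
  using has_derivative_linear D D2 by blast+

lemma B_nonzero:
  assumes "\<xi> \<noteq> 0" "Q \<xi> \<xi> = 0"
  shows "B \<xi> \<noteq> 0"
proof
  assume z: "B \<xi> = 0"
  then have "fst \<xi> = 0"
    using b_nonzero by (auto simp: vec_eq_iff diag_matrix_mult_nth)
  moreover have "snd \<xi> = 0"
    using z assms(2) by (simp add: quadric_form_def)
  ultimately show False
    using assms(1) by (simp add: prod_eq_iff)
qed

lemma B_\<Phi>_pos: "x \<in> U \<Longrightarrow> 0 < B (\<Phi> x) \<bullet> B (\<Phi> x)"
  using B_nonzero \<Phi>_nonzero Q_\<Phi> by simp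

lemma has_derivative_Q:
  assumes "(f has_derivative f') (at x)" "(g has_derivative g') (at x)"
  shows "((\<lambda>x. Q (f x) (g x)) has_derivative (\<lambda>v. Q (f x) (g' v) + Q (f' v) (g x))) (at x)"
  using bounded_bilinear.FDERIV [OF bounded_bilinear_quadric_form assms] .

lemma Q_\<Phi>_D:
  assumes "x \<in> U"
  shows "Q (\<Phi> x) (D x v) = 0"
proof -
  have "((\<lambda>y. Q (\<Phi> y) (\<Phi> y)) has_derivative (\<lambda>v. Q (\<Phi> x) (D x v) + Q (D x v) (\<Phi> x))) (at x)"
    by (intro has_derivative_Q D assms)
  moreover have "((\<lambda>y. Q (\<Phi> y) (\<Phi> y)) has_derivative (\<lambda>v. 0)) (at x)"
    by (rule has_derivative_transform_within_open [OF has_derivative_const open_U assms])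
      (simp add: Q_\<Phi>)
  ultimately have "(\<lambda>v. Q (\<Phi> x) (D x v) + Q (D x v) (\<Phi> x)) = (\<lambda>v. 0)"
    by (rule has_derivative_unique)
  from fun_cong [OF this, of v] show ?thesis
    by (simp add: quadric_form_sym [of b "D x v"])
qed

lemma has_derivative_weight:
  assumes "x \<in> U"
  shows "(weight has_derivative weight_deriv x) (at x)"
proof -
  have "((\<lambda>y. B (\<Phi> y)) has_derivative (\<lambda>v. B (D x v))) (at x)"
    by (rule bounded_linear.has_derivative [OF bounded_linear_diag_fst D [OF assms]])
  note has_derivative_inner [OF this this]
  from has_derivative_divide [OF has_derivative_const [of 1] this] show ?thesis
    unfolding weight_def [abs_def] weight_deriv_def [abs_def]
    using B_\<Phi>_pos [OF assms]
    by (simp add: inner_commute [of "B (D x _)"] power2_eq_square divide_simps)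
qed

text \<open>The dimension count: \<open>\<Phi> x\<close> and the image of \<open>D x\<close> span the hyperplane tangent to the cone.\<close>

lemma tangent_space:
  assumes x: "x \<in> U" and \<zeta>: "Q (\<Phi> x) \<zeta> = 0"
  obtains v c where "\<zeta> = D x v + c *\<^sub>R \<Phi> x"
proof -
  \<comment> \<open>E maps a space of dimension n + 1 into the hyperplane tangent to the cone. The
    immersion condition makes it injective, and the hyperplane has dimension (n + 2) - 1, so E is
    onto it.\<close>
  define E where "E = (\<lambda>(v, c). D x v + c *\<^sub>R \<Phi> x)"
  \<comment> \<open>The Euclidean normal of the tangent hyperplane, so that the dimension formula
    for hyperplanes applies.\<close>
  define a where "a = (B (\<Phi> x), - snd (\<Phi> x))"
  have a: "a \<bullet> \<eta> = Q (\<Phi> x) \<eta>" for \<eta>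
    by (simp add: a_def quadric_form_def inner_prod_def)
  have "a \<noteq> 0"
    using B_\<Phi>_pos [OF x] by (auto simp: a_def prod_eq_iff)
  have lin: "linear E"
    using linear_D [OF x] by (auto intro!: linearI simp: E_def linear_add linear_cmul algebra_simps)
  have "inj E"
  proof (subst linear_injective_0 [OF lin], safe)
    fix v c assume "E (v, c) = 0"
    then have e: "D x v = (- c) *\<^sub>R \<Phi> x"
      by (simp add: E_def eq_neg_iff_add_eq_0)
    then have "v = 0"
      by (intro immersion [OF x]) (simp only: e span_scale span_base singleton_iff)
    with e have "c = 0"
      using \<Phi>_nonzero [OF x] linear_0 [OF linear_D [OF x]] by simp
    with \<open>v = 0\<close> show "(v, c) = 0"
      by (simp add: zero_prod_def)
  qed
  then have "dim (range E) = DIM((real ^ 'n) \<times> real)"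
    using dim_image_eq [OF lin, of UNIV] by simp
  moreover have "dim {\<eta>. a \<bullet> \<eta> = 0} = DIM('n homog_vec) - 1"
    using \<open>a \<noteq> 0\<close> by (rule dim_hyperplane)
  moreover have "range E \<subseteq> {\<eta>. a \<bullet> \<eta> = 0}"
    unfolding a using x by (auto simp: E_def quadric_form_lin Q_\<Phi> Q_\<Phi>_D)
  ultimately have "range E = {\<eta>. a \<bullet> \<eta> = 0}"
    using lin by (intro subspace_dim_equal subspace_hyperplane linear_subspace_image) auto
  with \<zeta> a have "\<zeta> \<in> range E"
    by auto
  with that show thesis
    by (auto simp: E_def)
qed

text \<open>By nondegeneracy, the radical of Q on the hyperplane tangent to the cone is the line of
  the point itself, and \<open>tangent_space\<close> supplies the vectors on which to test.\<close>

lemma orthogonal_to_tangent_space: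
  assumes x: "x \<in> U" and "Q \<zeta> (\<Phi> x) = 0" "\<And>v. Q \<zeta> (D x v) = 0"
  shows "\<zeta> \<in> span {\<Phi> x}"
proof (rule quadric_metric_nondegenerate [OF b_nonzero \<Phi>_nonzero [OF x] Q_\<Phi> [OF x]])
  fix \<eta> assume "\<eta> \<in> quadric_tangent b (\<Phi> x)"
  then have "Q (\<Phi> x) \<eta> = 0"
    by (simp add: quadric_tangent_def)
  from tangent_space [OF x this] obtain v c where "\<eta> = D x v + c *\<^sub>R \<Phi> x" .
  with assms show "quadric_metric b (\<Phi> x) \<zeta> \<eta> = 0"
    by (simp add: quadric_metric_def quadric_form_lin)
qed

section \<open>The pullback metric and its derivatives\<close>

lemma pullback_metric_nth:
  "pullback_metric b \<Phi> x $ i $ j = weight x * Q (D x (axis i 1)) (D x (axis j 1))"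
  by (simp add: pullback_metric_def quadric_metric_def weight_def power2_norm_eq_inner)

lemma pullback_metric_mult:
  assumes "x \<in> U"
  shows "(pullback_metric b \<Phi> x *v v) $ l = weight x * Q (D x (axis l 1)) (D x v)"
proof -
  have "linear (\<lambda>v. weight x * Q (D x (axis l 1)) (D x v))"
    using linear_D [OF assms]
    by (auto intro!: linearI simp: linear_add linear_cmul quadric_form_lin algebra_simps)
  from sum_axis_linear [OF this, of v] show ?thesis
    by (simp add: matrix_vector_mult_def pullback_metric_nth mult_ac)
qed

text \<open>A kernel vector v gives \<open>D x v\<close> orthogonal to the whole tangent hyperplane,
  hence in the line of \<open>\<Phi> x\<close>, and the immersion condition forces v = 0.\<close>

lemma pullback_metric_invertible:
  assumes x: "x \<in> U"
  shows "invertible (pullback_metric b \<Phi> x)"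
  unfolding invertible_left_inverse matrix_left_invertible_ker
proof (intro allI impI)
  fix v assume v: "pullback_metric b \<Phi> x *v v = 0"
  have "Q (D x v) (D x w) = 0" for w
  proof -
    have "linear (\<lambda>w. Q (D x v) (D x w))"
      using linear_D [OF x]
      by (auto intro!: linearI simp: linear_add linear_cmul quadric_form_lin)
    from sum_axis_linear [OF this, of w]
    have "Q (D x v) (D x w) = (\<Sum>i\<in>UNIV. w $ i * Q (D x (axis i 1)) (D x v))"
      by (simp add: quadric_form_sym)
    moreover have "Q (D x (axis i 1)) (D x v) = 0" for i
      using pullback_metric_mult [OF x, of v i] v B_\<Phi>_pos [OF x] by (simp add: weight_def)
    ultimately show ?thesis
      by simp
  qed
  then have "D x v \<in> span {\<Phi> x}"
    using Q_\<Phi>_D [OF x] by (intro orthogonal_to_tangent_space x) (simp_all add: quadric_form_sym)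
  then show "v = 0"
    by (rule immersion [OF x])
qed

text \<open>The derivative in direction c of the pulled-back metric evaluated on the constant vector
  fields v and w, written out by the product rule.\<close>

definition metric_deriv :: "real ^ 'n \<Rightarrow> real ^ 'n \<Rightarrow> real ^ 'n \<Rightarrow> real ^ 'n \<Rightarrow> real"
  where "metric_deriv x c v w = weight_deriv x c * Q (D x v) (D x w)
    + weight x * (Q (D2 x v c) (D x w) + Q (D x v) (D2 x w c))"

lemma partial_deriv_pullback_metric:
  assumes x: "x \<in> U"
  shows "partial_deriv k (\<lambda>y. pullback_metric b \<Phi> y $ i $ j) x
    = metric_deriv x (axis k 1) (axis i 1) (axis j 1)"
proof -
  have "((\<lambda>y. weight y * Q (D y (axis i 1)) (D y (axis j 1))) has_derivative
      (\<lambda>c. metric_deriv x c (axis i 1) (axis j 1))) (at x)"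
    using has_derivative_mult [OF has_derivative_weight has_derivative_Q [OF D2 D2], OF x x x]
    by (simp add: metric_deriv_def [abs_def] add_ac)
  then show ?thesis
    unfolding partial_deriv_def pullback_metric_nth by (simp add: frechet_derivative_at [symmetric])
qed

text \<open>\<open>D2 x v c\<close> is linear in c as a derivative; its linearity in v comes from
  the symmetry of second derivatives.\<close>

lemma linear_metric_deriv:
  assumes x: "x \<in> U"
  shows "linear (\<lambda>c. metric_deriv x c v w)" "linear (\<lambda>w. metric_deriv x c v w)"
    "linear (\<lambda>v. metric_deriv x c v w)"
proof -
  note lin = linear_add [OF linear_D [OF x]] linear_cmul [OF linear_D [OF x]]
    linear_add [OF linear_D2 [OF x]] linear_cmul [OF linear_D2 [OF x]]
    linear_add [OF has_derivative_linear [OF has_derivative_weight [OF x]]]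
    linear_cmul [OF has_derivative_linear [OF has_derivative_weight [OF x]]]
  show "linear (\<lambda>c. metric_deriv x c v w)"
    by (rule linearI) (simp_all add: metric_deriv_def lin quadric_form_lin algebra_simps)
  show "linear (\<lambda>w. metric_deriv x c v w)" "linear (\<lambda>v. metric_deriv x c v w)"
    by (rule linearI;
        simp add: metric_deriv_def lin quadric_form_lin D2_sym [OF x, of _ c] algebra_simps)+
qed

text \<open>The lowered geodesic equation freed of indices: both sides are linear in w, so agreement
  on the coordinate vectors suffices.\<close>

lemma geodesic_euler_lagrange:
  fixes v :: "real ^ 'n"
  assumes x: "x \<in> U"
  defines "a \<equiv> \<chi> k. - (\<Sum>i\<in>UNIV. \<Sum>j\<in>UNIV. christoffel (pullback_metric b \<Phi>) x k i j * v $ i * v $ j)"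
  shows "weight x * Q (D x w) (D x a) = metric_deriv x w v v / 2 - metric_deriv x v w v"
proof -
  note lin = linear_add [OF linear_metric_deriv(1) [OF x]] linear_cmul [OF linear_metric_deriv(1) [OF x]]
    linear_add [OF linear_metric_deriv(2) [OF x]] linear_cmul [OF linear_metric_deriv(2) [OF x]]
    linear_add [OF linear_metric_deriv(3) [OF x]] linear_cmul [OF linear_metric_deriv(3) [OF x]]
  \<comment> \<open>A bilinear form contracted in coordinates with v twice is its value at (v,
    v).\<close>
  have expand: "(\<Sum>i\<in>UNIV. \<Sum>j\<in>UNIV. f (axis i 1) (axis j 1) * v $ i * v $ j) = f v v"
    if "\<And>u. linear (\<lambda>v. f v u)" "\<And>u. linear (f u)" for f :: "real ^ 'n \<Rightarrow> real ^ 'n \<Rightarrow> real"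
  proof -
    have "(\<Sum>i\<in>UNIV. \<Sum>j\<in>UNIV. f (axis i 1) (axis j 1) * v $ i * v $ j)
        = (\<Sum>i\<in>UNIV. v $ i *\<^sub>R (\<Sum>j\<in>UNIV. v $ j *\<^sub>R f (axis i 1) (axis j 1)))"
      by (simp add: sum_distrib_left mult_ac)
    then show ?thesis
      by (simp only: sum_axis_linear [OF that(2)] sum_axis_linear [OF that(1)])
  qed
  have comp: "weight x * Q (D x (axis l 1)) (D x a)
    = metric_deriv x (axis l 1) v v / 2 - metric_deriv x v (axis l 1) v" for l
  proof -
    have "weight x * Q (D x (axis l 1)) (D x a) = (\<Sum>i\<in>UNIV. \<Sum>j\<in>UNIV.
      (metric_deriv x (axis l 1) (axis i 1) (axis j 1) / 2
        - metric_deriv x (axis i 1) (axis l 1) (axis j 1)) * v $ i * v $ j)"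
      using geodesic_acceleration [where G = "pullback_metric b \<Phi>", OF pullback_metric_invertible [OF x],
          where v = v and l = l]
      by (simp add: pullback_metric_mult [OF x] partial_deriv_pullback_metric [OF x] a_def)
    also have "\<dots> = metric_deriv x (axis l 1) v v / 2 - metric_deriv x v (axis l 1) v"
      by (rule expand [of "\<lambda>c u. metric_deriv x (axis l 1) c u / 2 - metric_deriv x c (axis l 1) u"])
        (auto intro!: linearI simp: lin add_divide_distrib algebra_simps)
    finally show ?thesis .
  qed
  have "linear (\<lambda>w. weight x * Q (D x w) (D x a))"
    using linear_D [OF x]
    by (auto intro!: linearI simp: linear_add linear_cmul quadric_form_lin algebra_simps)
  moreover have "linear (\<lambda>w. metric_deriv x w v v / 2 - metric_deriv x v w v)"
    by (auto intro!: linearI simp: lin add_divide_distrib algebra_simps)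
  ultimately show ?thesis
    using sum_axis_linear [of "\<lambda>w. weight x * Q (D x w) (D x a)" w]
      sum_axis_linear [of "\<lambda>w. metric_deriv x w v v / 2 - metric_deriv x v w v" w]
    by (simp add: comp)
qed

section \<open>The acceleration of a normalized lift\<close>

lemma geodesic_unit_lift:
  assumes J: "open J" "\<And>t. t \<in> J \<Longrightarrow> u t \<in> U" "\<And>t. t \<in> J \<Longrightarrow> \<gamma> t = proj_point (\<Phi> (u t))"
    and geo: "geodesic_equation (pullback_metric b \<Phi>) J u"
    and vel: "\<And>t. t \<in> J \<Longrightarrow> has_velocity_square b \<gamma> t \<epsilon>"
  obtains \<xi> \<xi>' \<alpha> where
    "\<And>t. t \<in> J \<Longrightarrow> norm (B (\<xi> t)) = 1" "\<And>t. t \<in> J \<Longrightarrow> Q (\<xi> t) (\<xi> t) = 0"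
    "\<And>t. t \<in> J \<Longrightarrow> Q (\<xi>' t) (\<xi>' t) = \<epsilon>" "\<And>t. t \<in> J \<Longrightarrow> Q (\<xi> t) (\<xi>' t) = 0"
    "\<And>t. t \<in> J \<Longrightarrow> \<gamma> t = proj_point (\<xi> t)"
    "\<And>t. t \<in> J \<Longrightarrow> (\<xi> has_vector_derivative \<xi>' t) (at t)"
    "\<And>t. t \<in> J \<Longrightarrow> (\<xi>' has_vector_derivative \<alpha> t *\<^sub>R \<xi> t - \<epsilon> *\<^sub>R (B (\<xi> t), 0)) (at t)"
proof -
  define acc where "acc x v = (\<chi> k. - (\<Sum>i\<in>UNIV. \<Sum>j\<in>UNIV.
    christoffel (pullback_metric b \<Phi>) x k i j * v $ i * v $ j))" for x and v :: "real ^ 'n"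
  obtain u' where u': "\<And>t. t \<in> J \<Longrightarrow> (u has_vector_derivative u' t) (at t)"
    "\<And>t. t \<in> J \<Longrightarrow> (u' has_vector_derivative acc (u t) (u' t)) (at t)"
    using geo unfolding geodesic_equation_def acc_def by blast
  define \<eta> where "\<eta> t = \<Phi> (u t)" for t
  define \<eta>' where "\<eta>' t = D (u t) (u' t)" for t
  \<comment> \<open>The chain-rule value of the second derivative of \<open>\<Phi> (u t)\<close>,
    with the acceleration of u taken from the geodesic equation.\<close>
  define \<eta>'' where "\<eta>'' t = D (u t) (acc (u t) (u' t)) + D2 (u t) (u' t) (u' t)" for t
  have chain: "((\<lambda>t. F (u t)) has_vector_derivative F' (u' t)) (at t)"
    if "t \<in> J" "(F has_derivative F') (at (u t))" for F :: "real ^ 'n \<Rightarrow> 'n homog_vec" and F' t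
    using vector_derivative_diff_chain_within [of u "u' t" t UNIV F F'] u'(1) that
    by (simp add: o_def has_derivative_at_withinI)
  have d\<eta>: "(\<eta> has_vector_derivative \<eta>' t) (at t)" if "t \<in> J" for t
    unfolding \<eta>_def [abs_def] \<eta>'_def using that by (intro chain D J)
  have d\<eta>': "(\<eta>' has_vector_derivative \<eta>'' t) (at t)" if t: "t \<in> J" for t
  proof -
    \<comment> \<open>\<open>D2\<close> differentiates \<open>D y v\<close> only for fixed v, so the
      moving vector \<open>u' r\<close> is expanded in coordinates. Symmetry puts the coordinate
      vector in the linear slot, where the sum collapses again.\<close>
    have sym: "D2 (u t) (axis i 1) (u' t) = D2 (u t) (u' t) (axis i 1)" for i
      by (rule D2_sym [OF J(2) [OF t]])
    have "((\<lambda>r. \<Sum>i\<in>UNIV. u' r $ i *\<^sub>R D (u r) (axis i 1)) has_vector_derivative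
      (\<Sum>i\<in>UNIV. u' t $ i *\<^sub>R D2 (u t) (axis i 1) (u' t) + acc (u t) (u' t) $ i *\<^sub>R D (u t) (axis i 1)))
      (at t)"
    proof (intro has_vector_derivative_sum has_vector_derivative_scaleR chain D2 J t)
      fix i
      show "((\<lambda>r. u' r $ i) has_real_derivative acc (u t) (u' t) $ i) (at t)"
        unfolding has_real_derivative_iff_has_vector_derivative
        by (rule bounded_linear.has_vector_derivative [OF bounded_linear_vec_nth u'(2) [OF t]])
    qed
    also have "(\<Sum>i\<in>UNIV. u' t $ i *\<^sub>R D2 (u t) (axis i 1) (u' t)
        + acc (u t) (u' t) $ i *\<^sub>R D (u t) (axis i 1)) = \<eta>'' t"
      unfolding sum.distrib sym
        sum_axis_linear [OF linear_D2 [OF J(2) [OF t]]] sum_axis_linear [OF linear_D [OF J(2) [OF t]]]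
      by (simp add: \<eta>''_def)
    finally show ?thesis
      by (rule has_vector_derivative_transform_within_open [OF _ J(1) t])
        (simp add: \<eta>'_def sum_axis_linear [OF linear_D [OF J(2)]])
  qed
  have Q\<eta>: "Q (\<eta> t) (\<eta> t) = 0" "Q (\<eta> t) (\<eta>' t) = 0" if "t \<in> J" for t
    using J(2) [OF that] by (simp_all add: \<eta>_def \<eta>'_def Q_\<Phi> Q_\<Phi>_D)
  have Q\<eta>'': "Q (\<eta> t) (\<eta>'' t) = - Q (\<eta>' t) (\<eta>' t)" if t: "t \<in> J" for t
  proof -
    have "((\<lambda>r. Q (\<eta> r) (\<eta>' r)) has_vector_derivative Q (\<eta> t) (\<eta>'' t) + Q (\<eta>' t) (\<eta>' t)) (at t)"
      by (rule bounded_bilinear.has_vector_derivative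
          [OF bounded_bilinear_quadric_form d\<eta> [OF t] d\<eta>' [OF t]])
    moreover have "((\<lambda>r. Q (\<eta> r) (\<eta>' r)) has_vector_derivative 0) (at t)"
      by (rule has_vector_derivative_transform_within_open [OF has_vector_derivative_const J(1) t])
        (simp add: Q\<eta>)
    ultimately show ?thesis
      using vector_derivative_unique_at by fastforce
  qed
  define p where "p t = B (\<eta> t) \<bullet> B (\<eta>' t)" for t
  \<comment> \<open>The factor normalizing the lift to |Bx| = 1; its square is the conformal factor
    \<open>weight\<close>.\<close>
  define f where "f t = inverse (norm (B (\<eta> t)))" for t
  define f' where "f' t = - (p t * f t ^ 3)" for t
  have f_pos: "f t > 0" if "t \<in> J" for t
    using B_\<Phi>_pos [OF J(2) [OF that]] by (simp add: f_def \<eta>_def)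
  have f_sq: "(f t)\<^sup>2 = weight (u t)" for t
    by (simp add: f_def \<eta>_def weight_def power2_norm_eq_inner inverse_eq_divide power_divide)
  have dB: "((\<lambda>r. B (g r)) has_vector_derivative B g') (at t)"
    if "(g has_vector_derivative g') (at t)" for g :: "real \<Rightarrow> 'n homog_vec" and g' t
    by (rule bounded_linear.has_vector_derivative [OF bounded_linear_diag_fst that])
  have dinner: "((\<lambda>r. B (g r) \<bullet> B (h r)) has_real_derivative B (g t) \<bullet> B h' + B g' \<bullet> B (h t)) (at t)"
    if "(g has_vector_derivative g') (at t)" "(h has_vector_derivative h') (at t)"
    for g h :: "real \<Rightarrow> 'n homog_vec" and g' h' t
    unfolding has_real_derivative_iff_has_vector_derivative
    by (rule bounded_bilinear.has_vector_derivative [OF bounded_bilinear_inner dB dB, OF that])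
  have df: "(f has_real_derivative f' t) (at t)" if t: "t \<in> J" for t
  proof -
    have pos: "B (\<eta> t) \<bullet> B (\<eta> t) > 0"
      using B_\<Phi>_pos [OF J(2) [OF t]] by (simp add: \<eta>_def)
    have "((\<lambda>r. sqrt (B (\<eta> r) \<bullet> B (\<eta> r))) has_real_derivative
        (inverse (sqrt (B (\<eta> t) \<bullet> B (\<eta> t))) / 2) * (p t + p t)) (at t)"
      using DERIV_chain2 [OF DERIV_real_sqrt [OF pos] dinner [OF d\<eta> d\<eta>, OF t t]]
      by (simp add: p_def inner_commute)
    from DERIV_inverse' [OF this] show ?thesis
      unfolding f_def [abs_def] f'_def norm_eq_sqrt_inner
      using pos by (simp add: power3_eq_cube mult_ac)
  qed
  \<comment> \<open>Existence is enough: \<open>f''\<close> enters \<xi>'' only as a coefficient of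
    \<eta>, which is Q-orthogonal to all the vectors tested below.\<close>
  have "\<exists>f''. (f' has_real_derivative f'') (at t)" if t: "t \<in> J" for t
    unfolding f'_def [abs_def] p_def
    by (rule exI) (rule DERIV_minus [OF DERIV_mult
          [OF dinner [OF d\<eta> [OF t] d\<eta>' [OF t]] DERIV_power [OF df [OF t]]]])
  then obtain f'' where df': "\<And>t. t \<in> J \<Longrightarrow> (f' has_real_derivative f'' t) (at t)"
    by metis
  define \<xi> where "\<xi> t = f t *\<^sub>R \<eta> t" for t
  define \<xi>' where "\<xi>' t = f t *\<^sub>R \<eta>' t + f' t *\<^sub>R \<eta> t" for t
  define \<xi>'' where "\<xi>'' t = f t *\<^sub>R \<eta>'' t + (2 * f' t) *\<^sub>R \<eta>' t + f'' t *\<^sub>R \<eta> t" for t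
  have d\<xi>: "(\<xi> has_vector_derivative \<xi>' t) (at t)" if "t \<in> J" for t
    unfolding \<xi>_def [abs_def] \<xi>'_def
    using that by (intro has_vector_derivative_scaleR df d\<eta>)
  have d\<xi>': "(\<xi>' has_vector_derivative \<xi>'' t) (at t)" if t: "t \<in> J" for t
  proof -
    have "((\<lambda>r. f r *\<^sub>R \<eta>' r + f' r *\<^sub>R \<eta> r) has_vector_derivative
      (f t *\<^sub>R \<eta>'' t + f' t *\<^sub>R \<eta>' t) + (f' t *\<^sub>R \<eta>' t + f'' t *\<^sub>R \<eta> t)) (at t)"
      using t by (intro has_vector_derivative_add has_vector_derivative_scaleR df df' d\<eta> d\<eta>')
    then show ?thesis
      unfolding \<xi>'_def [abs_def] \<xi>''_def mult_2 scaleR_left_distrib by (simp only: add.assoc)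
  qed
  have \<epsilon>: "(f t)\<^sup>2 * Q (\<eta>' t) (\<eta>' t) = \<epsilon>" if t: "t \<in> J" for t
  proof -
    obtain \<zeta> \<zeta>' where \<zeta>: "\<forall>\<^sub>F r in nhds t. \<zeta> r \<noteq> 0 \<and> \<gamma> r = proj_point (\<zeta> r)"
      "(\<zeta> has_vector_derivative \<zeta>') (at t)" "\<epsilon> = quadric_metric b (\<zeta> t) \<zeta>' \<zeta>'"
      using vel [OF t] unfolding has_velocity_square_def by blast
    have "\<forall>\<^sub>F r in nhds t. r \<in> J"
      using J(1) t by (simp add: eventually_nhds_in_open)
    then have "\<forall>\<^sub>F r in nhds t. \<eta> r \<noteq> 0 \<and> \<gamma> r = proj_point (\<eta> r)"
      by eventually_elim (use J(2,3) \<Phi>_nonzero in \<open>auto simp: \<eta>_def\<close>)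
    from quadric_metric_lift_independent [OF b_nonzero \<zeta>(1,2) this d\<eta> Q\<eta>, OF t t t] show ?thesis
      by (simp add: \<zeta>(3) quadric_metric_def f_def power_inverse divide_inverse mult.commute)
  qed
  have Q_B: "Q (B \<zeta>, 0) \<theta> = B \<zeta> \<bullet> B \<theta>" for \<zeta> \<theta>
    by (simp add: quadric_form_def diag_matrix_self_adjoint)
  have B_scale: "B (c *\<^sub>R \<zeta>) = c *\<^sub>R B \<zeta>" for c \<zeta>
    by (simp add: matrix_vector_mult_scaleR)
  have norm_\<xi>: "norm (B (\<xi> t)) = 1" if "t \<in> J" for t
    using f_pos [OF that] unfolding \<xi>_def B_scale by (simp add: f_def)
  have ortho: "Q (\<xi>'' t + \<epsilon> *\<^sub>R (B (\<xi> t), 0)) (D (u t) w) = 0" if t: "t \<in> J" for t w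
  proof -
    define W where "W = D (u t) w"
    \<comment> \<open>The terms with the mixed second derivative in directions w and
      \<open>u' t\<close> cancel by symmetry. The derivative of the weight along the curve is 2 f
      f', and along w it yields the term with B.\<close>
    have EL: "(f t)\<^sup>2 * Q W (\<eta>'' t)
      = - (f t)\<^sup>2 * (B (\<eta> t) \<bullet> B W) * ((f t)\<^sup>2 * Q (\<eta>' t) (\<eta>' t)) - 2 * f t * f' t * Q W (\<eta>' t)"
      using geodesic_euler_lagrange [OF J(2) [OF t], where v = "u' t" and w = w]
      unfolding acc_def [symmetric] metric_deriv_def weight_deriv_def f_sq [symmetric]
        D2_sym [OF J(2) [OF t], of w "u' t"]
      by (simp add: \<eta>'_def \<eta>''_def \<eta>_def f'_def p_def W_def quadric_form_lin
          quadric_form_sym [of b "D2 _ _ _"] power2_eq_square power3_eq_cube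
          add_divide_distrib diff_divide_distrib algebra_simps)
    have W\<eta>: "Q W (\<eta> t) = 0"
      using Q_\<Phi>_D [OF J(2) [OF t], of w] by (simp add: W_def \<eta>_def quadric_form_sym)
    have BW: "Q (B (\<xi> t), 0) W = f t * (B (\<eta> t) \<bullet> B W)"
      unfolding Q_B unfolding \<xi>_def B_scale by simp
    have "Q (\<xi>'' t + \<epsilon> *\<^sub>R (B (\<xi> t), 0)) W
      = f t * Q W (\<eta>'' t) + 2 * f' t * Q W (\<eta>' t) + \<epsilon> * f t * (B (\<eta> t) \<bullet> B W)"
      unfolding quadric_form_lin BW \<xi>''_def
      by (simp add: quadric_form_sym [of b _ W] W\<eta>)
    then have "f t * Q (\<xi>'' t + \<epsilon> *\<^sub>R (B (\<xi> t), 0)) W = 0"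
      using EL unfolding \<epsilon> [OF t] by (simp add: power2_eq_square algebra_simps)
    then show ?thesis
      using f_pos [OF t] by (simp add: W_def)
  qed
  have "\<exists>\<alpha>. \<xi>'' t = \<alpha> *\<^sub>R \<xi> t - \<epsilon> *\<^sub>R (B (\<xi> t), 0)" if t: "t \<in> J" for t
  proof -
    \<comment> \<open>Against \<xi>, the acceleration contributes -\<epsilon> and the correction
      contributes \<epsilon> |Bx|^2 = \<epsilon>. With \<open>ortho\<close> this covers the whole
      tangent hyperplane.\<close>
    have "Q (\<xi>'' t + \<epsilon> *\<^sub>R (B (\<xi> t), 0)) (\<Phi> (u t)) = 0"
    proof -
      have n: "B (\<xi> t) \<bullet> B (\<xi> t) = 1"
        using norm_\<xi> [OF t] by (simp add: norm_eq_1)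
      have scale: "f t * Q \<zeta> (\<Phi> (u t)) = Q \<zeta> (\<xi> t)" for \<zeta>
        by (simp add: \<xi>_def \<eta>_def quadric_form_lin)
      have "f t * Q (\<xi>'' t + \<epsilon> *\<^sub>R (B (\<xi> t), 0)) (\<Phi> (u t)) = Q (\<xi>'' t) (\<xi> t) + \<epsilon>"
        using scale [of "\<xi>'' t + \<epsilon> *\<^sub>R (B (\<xi> t), 0)"] by (simp only: quadric_form_lin Q_B n mult_1_right)
      also have "Q (\<xi>'' t) (\<xi> t) = - ((f t)\<^sup>2 * Q (\<eta>' t) (\<eta>' t))"
        using Q\<eta> [OF t] Q\<eta>'' [OF t]
          quadric_form_sym [of b "\<eta>' t" "\<eta> t"] quadric_form_sym [of b "\<eta>'' t" "\<eta> t"]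
        by (simp add: \<xi>_def \<xi>''_def quadric_form_lin power2_eq_square)
      finally show ?thesis
        using \<epsilon> [OF t] f_pos [OF t] by simp
    qed
    then have "\<xi>'' t + \<epsilon> *\<^sub>R (B (\<xi> t), 0) \<in> span {\<Phi> (u t)}"
      by (intro orthogonal_to_tangent_space J t ortho)
    also have "span {\<Phi> (u t)} = span {\<xi> t}"
      using f_pos [OF t] by (simp add: \<xi>_def \<eta>_def span_singleton_scaleR)
    finally obtain \<alpha> where "\<xi>'' t + \<epsilon> *\<^sub>R (B (\<xi> t), 0) = \<alpha> *\<^sub>R \<xi> t"
      unfolding span_singleton by blast
    then show ?thesis
      by (metis add_diff_cancel_right')
  qed
  then obtain \<alpha> where \<alpha>: "\<And>t. t \<in> J \<Longrightarrow> \<xi>'' t = \<alpha> t *\<^sub>R \<xi> t - \<epsilon> *\<^sub>R (B (\<xi> t), 0)"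
    by metis
  show thesis
  proof
    fix t assume t: "t \<in> J"
    show "norm (B (\<xi> t)) = 1" "(\<xi> has_vector_derivative \<xi>' t) (at t)"
      using t by (fact norm_\<xi> d\<xi>)+
    show "Q (\<xi> t) (\<xi> t) = 0" "Q (\<xi>' t) (\<xi>' t) = \<epsilon>" "Q (\<xi> t) (\<xi>' t) = 0"
      using Q\<eta> [OF t] \<epsilon> [OF t] quadric_form_sym [of b "\<eta>' t" "\<eta> t"]
      by (simp_all add: \<xi>_def \<xi>'_def quadric_form_lin power2_eq_square mult.assoc)
    show "\<gamma> t = proj_point (\<xi> t)"
      using f_pos [OF t] by (simp add: J(3) [OF t] \<xi>_def \<eta>_def proj_point_def span_singleton_scaleR)
    show "(\<xi>' has_vector_derivative \<alpha> t *\<^sub>R \<xi> t - \<epsilon> *\<^sub>R (B (\<xi> t), 0)) (at t)"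
      using d\<xi>' [OF t] by (simp add: \<alpha> [OF t])
  qed
qed

end

section \<open>Neumann solutions\<close>

text \<open>Writing p and q as images under B removes the inverse matrix, leaving expressions that
  the quadric equation controls.\<close>

lemma Psi_0_diag:
  fixes b x y :: "real ^ 'k"
  assumes b: "\<And>i. b $ i \<noteq> 0" and \<epsilon>: "\<epsilon> = 1 \<or> \<epsilon> = -1"
  shows "Psi b \<epsilon> 0 (diag_matrix b *v y) (diag_matrix b *v x)
    = (- \<epsilon> + y \<bullet> (diag_matrix b *v y)) * (x \<bullet> (diag_matrix b *v x)) - (y \<bullet> (diag_matrix b *v x))\<^sup>2"
proof -
  have "invertible (diag_matrix b)"
    unfolding invertible_left_inverse matrix_left_invertible_ker
    using b by (auto simp: vec_eq_iff diag_matrix_mult_nth)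
  then have "matrix_inv (diag_matrix b) ** diag_matrix b = mat 1"
    using someI_ex [of "\<lambda>A'. diag_matrix b ** A' = mat 1 \<and> A' ** diag_matrix b = mat 1"]
    by (auto simp: invertible_def matrix_inv_def)
  then have "matrix_inv (diag_matrix b) *v (diag_matrix b *v v) = v" for v
    by (simp add: matrix_vector_mul_assoc)
  then show ?thesis
    by (simp add: Psi_0 [OF b \<epsilon>])
qed

lemma neumann_solution_of_unit_lift:
  fixes b :: "real ^ ('n::finite option)" and \<xi> \<xi>' :: "real \<Rightarrow> 'n homog_vec"
  assumes J: "open J"
    and unit: "\<And>t. t \<in> J \<Longrightarrow> norm (diag_matrix b *v fst (\<xi> t)) = 1"
    and d\<xi>: "\<And>t. t \<in> J \<Longrightarrow> (\<xi> has_vector_derivative \<xi>' t) (at t)"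
    and d\<xi>': "\<And>t. t \<in> J \<Longrightarrow> (\<xi>' has_vector_derivative
      \<alpha> t *\<^sub>R \<xi> t - \<epsilon> *\<^sub>R (diag_matrix b *v fst (\<xi> t), 0)) (at t)"
  shows "neumann_solution b \<epsilon> J (\<lambda>t. diag_matrix b *v fst (\<xi>' t)) (\<lambda>t. diag_matrix b *v fst (\<xi> t))"
proof -
  define q where "q t = diag_matrix b *v fst (\<xi> t)" for t
  define p where "p t = diag_matrix b *v fst (\<xi>' t)" for t
  have dq: "(q has_vector_derivative p t) (at t)" if "t \<in> J" for t
    unfolding q_def [abs_def] p_def
    by (rule bounded_linear.has_vector_derivative [OF bounded_linear_diag_fst d\<xi> [OF that]])
  have dp: "(p has_vector_derivative \<alpha> t *\<^sub>R q t - \<epsilon> *\<^sub>R (diag_matrix b *v q t)) (at t)"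
    if "t \<in> J" for t
    using bounded_linear.has_vector_derivative [OF bounded_linear_diag_fst [of b] d\<xi>' [OF that]]
    by (simp add: p_def [abs_def] q_def matrix_vector_mult_diff_distrib matrix_vector_mult_scaleR)
  have const: "f' = 0" if "t \<in> J" "(f has_vector_derivative f') (at t)" "\<And>r. r \<in> J \<Longrightarrow> f r = c"
    for f :: "real \<Rightarrow> real" and f' c t
  proof -
    have "(f has_vector_derivative 0) (at t)"
      by (rule has_vector_derivative_transform_within_open [OF has_vector_derivative_const [of c] J])
        (use that in auto)
    with that(2) show ?thesis
      using vector_derivative_unique_at by blast
  qed
  have qq: "q t \<bullet> q t = 1" if "t \<in> J" for t
    using unit [OF that] by (simp add: q_def norm_eq_1)
  have qp: "q t \<bullet> p t = 0" if t: "t \<in> J" for t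
    using const [OF t bounded_bilinear.has_vector_derivative [OF bounded_bilinear_inner dq dq] qq, OF t t]
    by (simp add: inner_commute)
  \<comment> \<open>Differentiating (q, p) = 0 and inserting the equation for p' determines the
    multiplier.\<close>
  have \<mu>: "\<alpha> t = \<epsilon> * ((diag_matrix b *v q t) \<bullet> q t) - p t \<bullet> p t" if t: "t \<in> J" for t
    using const [OF t bounded_bilinear.has_vector_derivative [OF bounded_bilinear_inner dq dp] qp, OF t t]
    by (simp add: inner_diff_right qq [OF t] inner_commute)
  have "neumann_solution b \<epsilon> J p q"
    unfolding neumann_solution_def Let_def
  proof (intro ballI conjI)
    fix t assume t: "t \<in> J"
    show "norm (q t) = 1"
      using qq [OF t] by (simp add: norm_eq_1)
    show "(q has_vector_derivative p t) (at t)"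
      using dq [OF t] .
    show "(p has_vector_derivative - \<epsilon> *\<^sub>R (diag_matrix b *v q t)
        + (\<epsilon> * ((diag_matrix b *v q t) \<bullet> q t) - p t \<bullet> p t) *\<^sub>R q t) (at t)"
      using dp [OF t] unfolding \<mu> [OF t] by (simp add: add.commute)
  qed
  then show ?thesis
    unfolding p_def [abs_def] q_def [abs_def] .
qed

text \<open>A geodesic carries a parametrization only near each time, so the solution is first built
  near t, with an arbitrary sign of q.\<close>

lemma local_neumann_solution:
  fixes b :: "real ^ ('n::finite option)"
  assumes b: "\<And>i. b $ i \<noteq> 0" and geo: "quadric_geodesic b I \<gamma>" and \<epsilon>: "\<epsilon> = 1 \<or> \<epsilon> = -1"
    and vel: "\<forall>t\<in>I. has_velocity_square b \<gamma> t \<epsilon>" and t: "t \<in> I"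
  obtains J p q where "open J" "t \<in> J" "J \<subseteq> I" "neumann_solution b \<epsilon> J p q"
    "\<And>s. s \<in> J \<Longrightarrow> knoerrer_map b (\<gamma> s) = proj_point (q s)"
    "\<And>s. s \<in> J \<Longrightarrow> Psi b \<epsilon> 0 (p s) (q s) = 0"
proof -
  have "\<exists>U \<Phi> J u. local_parametrization b U \<Phi> \<and> open J \<and> t \<in> J \<and> J \<subseteq> I
      \<and> (\<forall>s\<in>J. u s \<in> U \<and> \<gamma> s = proj_point (\<Phi> (u s)))
      \<and> geodesic_equation (pullback_metric b \<Phi>) J u"
    using geo t unfolding quadric_geodesic_def by (rule bspec)
  then obtain U \<Phi> J u where "local_parametrization b U \<Phi> \<and> open J \<and> t \<in> J \<and> J \<subseteq> I
      \<and> (\<forall>s\<in>J. u s \<in> U \<and> \<gamma> s = proj_point (\<Phi> (u s)))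
      \<and> geodesic_equation (pullback_metric b \<Phi>) J u"
    by (elim exE)
  then have par: "local_parametrization b U \<Phi>" and J: "open J" "t \<in> J" "J \<subseteq> I"
    and u: "\<And>s. s \<in> J \<Longrightarrow> u s \<in> U" "\<And>s. s \<in> J \<Longrightarrow> \<gamma> s = proj_point (\<Phi> (u s))"
    and eq: "geodesic_equation (pullback_metric b \<Phi>) J u"
    by simp_all
  interpret quadric_chart b U \<Phi>
    by unfold_locales (use b par in auto)
  have vel': "has_velocity_square b \<gamma> s \<epsilon>" if "s \<in> J" for s
    using vel J(3) that by blast
  obtain \<xi> \<xi>' \<alpha> where \<xi>:
    "\<And>t. t \<in> J \<Longrightarrow> norm (B (\<xi> t)) = 1" "\<And>t. t \<in> J \<Longrightarrow> Q (\<xi> t) (\<xi> t) = 0"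
    "\<And>t. t \<in> J \<Longrightarrow> Q (\<xi>' t) (\<xi>' t) = \<epsilon>" "\<And>t. t \<in> J \<Longrightarrow> Q (\<xi> t) (\<xi>' t) = 0"
    "\<And>t. t \<in> J \<Longrightarrow> \<gamma> t = proj_point (\<xi> t)"
    "\<And>t. t \<in> J \<Longrightarrow> (\<xi> has_vector_derivative \<xi>' t) (at t)"
    "\<And>t. t \<in> J \<Longrightarrow> (\<xi>' has_vector_derivative \<alpha> t *\<^sub>R \<xi> t - \<epsilon> *\<^sub>R (B (\<xi> t), 0)) (at t)"
    by (rule geodesic_unit_lift [OF J(1) u eq vel']) (assumption | rule that)+
  show thesis
  proof
    show "neumann_solution b \<epsilon> J (\<lambda>t. B (\<xi>' t)) (\<lambda>t. B (\<xi> t))"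
      by (rule neumann_solution_of_unit_lift [OF J(1) \<xi>(1,6,7)])
    fix s assume s: "s \<in> J"
    show "knoerrer_map b (\<gamma> s) = proj_point (B (\<xi> s))"
      by (simp add: \<xi>(5) [OF s] knoerrer_map_proj_point)
    have "fst (\<xi> s) \<bullet> B (\<xi> s) = (snd (\<xi> s))\<^sup>2" "fst (\<xi>' s) \<bullet> B (\<xi>' s) = \<epsilon> + (snd (\<xi>' s))\<^sup>2"
      "fst (\<xi>' s) \<bullet> B (\<xi> s) = snd (\<xi> s) * snd (\<xi>' s)"
      using \<xi>(2-4) [OF s] by (simp_all add: quadric_form_def power2_eq_square inner_commute)
    then show "Psi b \<epsilon> 0 (B (\<xi>' s)) (B (\<xi> s)) = 0"
      unfolding Psi_0_diag [OF b \<epsilon>] by (simp add: power_mult_distrib)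
  qed (use J in auto)
qed

section \<open>Gluing the local solutions with a consistent sign\<close>

theorem theorem9p6:
  fixes b :: "real ^ (('n::{finite,linorder}) option)"
    and \<epsilon> :: real and I :: "real set" and \<gamma> :: "real \<Rightarrow> 'n homog_vec set"
  assumes "b $ None < 0"
    and "\<forall>k. 0 < b $ Some k"
    and "\<forall>j k. j < k \<longrightarrow> b $ Some j < b $ Some k"
    and "open I" and "is_interval I"
    and "quadric_geodesic b I \<gamma>"
    and "\<epsilon> = 1 \<or> \<epsilon> = -1"
    and "\<forall>t\<in>I. has_velocity_square b \<gamma> t \<epsilon>"
  shows "\<exists>p q. neumann_solution b \<epsilon> I p q
    \<and> (\<forall>t\<in>I. knoerrer_map b (\<gamma> t) = proj_point (q t))
    \<and> (\<forall>t\<in>I. Psi b \<epsilon> 0 (p t) (q t) = 0)"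
proof -
  have "b $ i \<noteq> 0" for i
    using assms(1) assms(2) [rule_format, of "the i"] by (cases i) auto
  note local_solution = local_neumann_solution [OF this assms(6-8)]
  have "\<exists>J f. open J \<and> t \<in> J \<and> J \<subseteq> I \<and> continuous_on J f
      \<and> (\<forall>s\<in>J. norm (f s) = 1 \<and> knoerrer_map b (\<gamma> s) = span {f s})" if t: "t \<in> I" for t
  proof -
    obtain J p q where J: "open J" "t \<in> J" "J \<subseteq> I" and sol: "neumann_solution b \<epsilon> J p q"
      and "\<And>s. s \<in> J \<Longrightarrow> knoerrer_map b (\<gamma> s) = proj_point (q s)"
      and "\<And>s. s \<in> J \<Longrightarrow> Psi b \<epsilon> 0 (p s) (q s) = 0"
      by (rule local_solution [OF t]) (rule that)
    moreover have "continuous_on J q"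
      using sol unfolding neumann_solution_def
      by (intro continuous_at_imp_continuous_on) (auto intro: has_vector_derivative_continuous)
    ultimately show ?thesis
      unfolding neumann_solution_def proj_point_def by blast
  qed
  then obtain q where q: "continuous_on I q"
    "\<And>t. t \<in> I \<Longrightarrow> norm (q t) = 1 \<and> knoerrer_map b (\<gamma> t) = span {q t}"
    by (rule continuous_unit_lift [OF assms(4,5), of "\<lambda>t. knoerrer_map b (\<gamma> t)"])
      (assumption | rule that)+
  \<comment> \<open>Taken as the derivative of the continuous lift q, p is globally defined; the
    local solutions serve only to verify its properties.\<close>
  define p where "p t = vector_derivative q (at t)" for t
  \<comment> \<open>The predicate is a conjunction over single times, with derivatives taken in full
    neighbourhoods, so one time at a time suffices.\<close>
  have "neumann_solution b \<epsilon> {t} p q \<and> Psi b \<epsilon> 0 (p t) (q t) = 0" if t: "t \<in> I" for t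
  proof -
    obtain J p0 q0 where J: "open J" "t \<in> J" "J \<subseteq> I" and sol: "neumann_solution b \<epsilon> J p0 q0"
      and L: "\<And>s. s \<in> J \<Longrightarrow> knoerrer_map b (\<gamma> s) = proj_point (q0 s)"
      and Psi: "\<And>s. s \<in> J \<Longrightarrow> Psi b \<epsilon> 0 (p0 s) (q0 s) = 0"
      by (rule local_solution [OF t]) (rule that)
    have n0: "norm (q0 r) = 1" and dq0: "(q0 has_vector_derivative p0 r) (at r)"
      and dp0: "(p0 has_vector_derivative - \<epsilon> *\<^sub>R (diag_matrix b *v q0 r)
        + (\<epsilon> * ((diag_matrix b *v q0 r) \<bullet> q0 r) - p0 r \<bullet> p0 r) *\<^sub>R q0 r) (at r)" if "r \<in> J" for r
      using sol that unfolding neumann_solution_def Let_def by auto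
    \<comment> \<open>The relative sign of two unit vectors spanning the same line.\<close>
    define g where "g r = q r \<bullet> q0 r" for r
    have g: "q r = g r *\<^sub>R q0 r" "g r = 1 \<or> g r = -1" if r: "r \<in> J" for r
    proof -
      have "q r \<in> span {q0 r}"
        using q(2) [of r] L [OF r] J(3) r span_base [of "q r" "{q r}"] by (auto simp: proj_point_def)
      then obtain c where c: "q r = c *\<^sub>R q0 r"
        by (auto simp: span_singleton)
      then have "g r = c"
        using n0 [OF r] by (simp add: g_def norm_eq_1)
      moreover have "\<bar>c\<bar> = 1"
        using n0 [OF r] q(2) [of r] J(3) r c by auto
      moreover note c
      ultimately show "q r = g r *\<^sub>R q0 r" "g r = 1 \<or> g r = -1"
        by auto
    qed
    define s where "s = g t"
    have s: "s = 1 \<or> s = -1"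
      using g(2) [OF J(2)] by (simp add: s_def)
    have "continuous_on J q0"
      using dq0 by (intro continuous_at_imp_continuous_on) (auto intro: has_vector_derivative_continuous)
    then have "continuous_on J g"
      unfolding g_def [abs_def] by (intro continuous_intros continuous_on_subset [OF q(1) J(3)])
    \<comment> \<open>The unit ball around s contains only one of 1 and -1, so the sign is constant
      on S.\<close>
    define S where "S = J \<inter> g -` ball s 1"
    have S: "open S" "t \<in> S" "S \<subseteq> J"
      using continuous_open_preimage [OF \<open>continuous_on J g\<close> J(1) open_ball] J(2)
      by (auto simp: S_def s_def)
    have qS: "s *\<^sub>R q0 r = q r" if "r \<in> S" for r
    proof -
      have "r \<in> J" "dist s (g r) < 1"
        using that by (auto simp: S_def)
      then have "g r = s"
        using s g(2) [of r] by (auto simp: dist_real_def)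
      then show ?thesis
        using g(1) [OF \<open>r \<in> J\<close>] by simp
    qed
    have dq: "(q has_vector_derivative s *\<^sub>R p0 r) (at r)" if r: "r \<in> S" for r
    proof (rule has_vector_derivative_transform_within_open [OF _ S(1) r qS])
      show "((\<lambda>r. s *\<^sub>R q0 r) has_vector_derivative s *\<^sub>R p0 r) (at r)"
        using r S(3)
        by (intro bounded_linear.has_vector_derivative [OF bounded_linear_scaleR_right] dq0) auto
    qed
    have pS: "s *\<^sub>R p0 r = p r" if "r \<in> S" for r
      unfolding p_def using vector_derivative_at [OF dq [OF that]] by simp
    have dp: "(p has_vector_derivative s *\<^sub>R (- \<epsilon> *\<^sub>R (diag_matrix b *v q0 t)
        + (\<epsilon> * ((diag_matrix b *v q0 t) \<bullet> q0 t) - p0 t \<bullet> p0 t) *\<^sub>R q0 t)) (at t)"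
    proof (rule has_vector_derivative_transform_within_open [OF _ S(1,2) pS])
      show "((\<lambda>r. s *\<^sub>R p0 r) has_vector_derivative s *\<^sub>R (- \<epsilon> *\<^sub>R (diag_matrix b *v q0 t)
        + (\<epsilon> * ((diag_matrix b *v q0 t) \<bullet> q0 t) - p0 t \<bullet> p0 t) *\<^sub>R q0 t)) (at t)"
        by (intro bounded_linear.has_vector_derivative [OF bounded_linear_scaleR_right] dp0 J)
    qed
    have eq: "q t = s *\<^sub>R q0 t" "p t = s *\<^sub>R p0 t"
      using qS [OF S(2)] pS [OF S(2)] by simp_all
    have ss: "s * s = 1"
      using s by auto
    \<comment> \<open>The system is invariant under a simultaneous sign change of p and q: its
      multiplier is quadratic, so s enters it only through \<open>s * s = 1\<close>.\<close>
    have "neumann_solution b \<epsilon> {t} p q"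
      using dq [OF S(2)] dp q(2) [OF t] ss s
      by (auto simp: neumann_solution_def Let_def eq matrix_vector_mult_scaleR algebra_simps)
    moreover have "Psi b \<epsilon> 0 (p t) (q t) = Psi b \<epsilon> 0 (p0 t) (q0 t)"
      using s by (auto simp: Psi_def eq matrix_vector_mult_scaleR)
    ultimately show ?thesis
      using Psi [OF J(2)] by simp
  qed
  then have "neumann_solution b \<epsilon> I p q" "\<forall>t\<in>I. Psi b \<epsilon> 0 (p t) (q t) = 0"
    by (auto simp: neumann_solution_def)
  moreover have "\<forall>t\<in>I. knoerrer_map b (\<gamma> t) = proj_point (q t)"
    using q(2) by (simp add: proj_point_def)
  ultimately show ?thesis
    by blast
qed

end
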